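(* Let $n\geq 3$ and, for $0<r<1$, let $A_r=B_1\setminus \overline{B_r}\subset\mathbb{R}^n$. There is $r_0\in(0,1)$ such that for every $0<r<r_0$ there is a Riemannian metric $g$ on $A_r$ (smooth up to the boundary $\partial A_r$) which is conformally equivalent to the Euclidean metric, has zero scalar curvature, and for which $$\frac{|A_r|_g^{1/n}}{|\partial A_r|_g^{1/(n-1)}}\ >\ \frac{|B_1|^{1/n}}{|\partial B_1|^{1/(n-1)}}= n^{-1/(n-1)}\,\omega_n^{-1/(n(n-1))}.$$
   Context: $B_r$ is the ball of radius $r$ in $\mathbb{R}^n$ centered at the origin; thus $A_r=\{x: r<|x|<1\}$ and $\partial A_r=\partial B_1\cup\partial B_r$. $\omega_n=|B_1|$ is the Euclidean volume of the unit ball and $|\partial B_1|=n\omega_n$ its Euclidean surface area. For a Riemannian metric $g$, $|A_r|_g$ denotes the $g$-volume of $A_r$ and $|\partial A_r|_g$ the $(n-1)$-dimensional area of $\partial A_r$ with respect to the metric induced by $g$. A metric $g$ is conformally equivalent to the Euclidean metric $g_0$ if $g=\varphi g_0$ for some smooth positive function $\varphi$. *)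

theory Defs
  imports "HOL-Analysis.Analysis"
begin

section \<open>Smooth functions\<close>

definition partial :: "'n::finite \<Rightarrow> (real^'n \<Rightarrow> real) \<Rightarrow> real^'n \<Rightarrow> real" where
  "partial i f x = frechet_derivative f (at x) (axis i 1)"

primrec C_diff :: "nat \<Rightarrow> (real^'n::finite) set \<Rightarrow> (real^'n \<Rightarrow> real) \<Rightarrow> bool" where
  "C_diff 0 U f \<longleftrightarrow> continuous_on U f"
| "C_diff (Suc k) U f \<longleftrightarrow> (\<forall>x\<in>U. f differentiable (at x)) \<and> (\<forall>i. C_diff k U (partial i f))"

text \<open>Smoothness on an arbitrary set means that there is a smooth extension to an open
  neighbourhood; on the closure of a domain with smooth boundary this is smoothness up to the
  boundary.\<close>

definition smooth_on :: "(real^'n::finite) set \<Rightarrow> (real^'n \<Rightarrow> real) \<Rightarrow> bool" where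
  "smooth_on S f \<longleftrightarrow>
     (\<exists>U h. open U \<and> S \<subseteq> U \<and> (\<forall>k. C_diff k U h) \<and> (\<forall>x\<in>S. h x = f x))"

section \<open>Riemannian metrics in the standard coordinates\<close>

text \<open>A metric is given by its coefficient matrix: \<open>g x $ i $ j\<close> is $g_{ij}(x)$.\<close>

definition riemannian_metric_on :: "(real^'n::finite) set \<Rightarrow> (real^'n \<Rightarrow> real^'n^'n) \<Rightarrow> bool" where
  "riemannian_metric_on S g \<longleftrightarrow>
     (\<forall>i j. smooth_on S (\<lambda>x. g x $ i $ j)) \<and>
     (\<forall>x\<in>S. transpose (g x) = g x \<and> (\<forall>v. v \<noteq> 0 \<longrightarrow> v \<bullet> (g x *v v) > 0))"

definition flat_metric :: "real^'n::finite \<Rightarrow> real^'n^'n" where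
  "flat_metric x = mat 1"

definition conformally_equivalent_on ::
    "(real^'n::finite) set \<Rightarrow> (real^'n \<Rightarrow> real^'n^'n) \<Rightarrow> (real^'n \<Rightarrow> real^'n^'n) \<Rightarrow> bool" where
  "conformally_equivalent_on S g h \<longleftrightarrow>
     (\<exists>\<phi>. smooth_on S \<phi> \<and> (\<forall>x\<in>S. \<phi> x > 0 \<and> g x = \<phi> x *\<^sub>R h x))"

definition christoffel ::
    "(real^'n::finite \<Rightarrow> real^'n^'n) \<Rightarrow> 'n \<Rightarrow> 'n \<Rightarrow> 'n \<Rightarrow> real^'n \<Rightarrow> real" where
  "christoffel g k i j x =
     (1/2) * (\<Sum>l\<in>UNIV. matrix_inv (g x) $ k $ l *
        (partial i (\<lambda>y. g y $ j $ l) x + partial j (\<lambda>y. g y $ i $ l) x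
         - partial l (\<lambda>y. g y $ i $ j) x))"

definition ricci ::
    "(real^'n::finite \<Rightarrow> real^'n^'n) \<Rightarrow> 'n \<Rightarrow> 'n \<Rightarrow> real^'n \<Rightarrow> real" where
  "ricci g i j x =
     (\<Sum>k\<in>UNIV. partial k (christoffel g k i j) x - partial j (christoffel g k i k) x)
     + (\<Sum>k\<in>UNIV. \<Sum>l\<in>UNIV. christoffel g k k l x * christoffel g l i j x
                           - christoffel g k j l x * christoffel g l i k x)"

definition scalar_curvature :: "(real^'n::finite \<Rightarrow> real^'n^'n) \<Rightarrow> real^'n \<Rightarrow> real" where
  "scalar_curvature g x = (\<Sum>i\<in>UNIV. \<Sum>j\<in>UNIV. matrix_inv (g x) $ i $ j * ricci g i j x)"

section \<open>Volume and area\<close>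

definition metric_volume :: "(real^'n::finite \<Rightarrow> real^'n^'n) \<Rightarrow> (real^'n) set \<Rightarrow> real" where
  "metric_volume g S = (\<integral>x\<in>S. sqrt (det (g x)) \<partial>lborel)"

text \<open>A submanifold of dimension \<open>card I\<close> is parametrized by \<open>\<Phi> y\<close>, where the parameters
  \<open>y i\<close> are indexed by \<open>i \<in> I\<close>.  Its area is the integral of $\sqrt{\det h}$ with
  $h_{ij} = g(\partial_i \Phi, \partial_j \Phi)$, $i,j \in I$, the metric induced by \<open>g\<close>.  To stay
  within square matrices over the type \<open>'n\<close>, \<open>h\<close> is padded by the identity outside \<open>I\<close>, which does
  not change the determinant.\<close>

definition chart_tangent ::
    "(('n::finite \<Rightarrow> real) \<Rightarrow> real^'n) \<Rightarrow> 'n \<Rightarrow> ('n \<Rightarrow> real) \<Rightarrow> real^'n" where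
  "chart_tangent \<Phi> i y = vector_derivative (\<lambda>t. \<Phi> (y(i := t))) (at (y i))"

definition induced_metric ::
    "(real^'n::finite \<Rightarrow> real^'n^'n) \<Rightarrow> 'n set \<Rightarrow> (('n \<Rightarrow> real) \<Rightarrow> real^'n) \<Rightarrow>
     ('n \<Rightarrow> real) \<Rightarrow> real^'n^'n" where
  "induced_metric g I \<Phi> y =
     (\<chi> i j. if i \<in> I \<and> j \<in> I
             then chart_tangent \<Phi> i y \<bullet> (g (\<Phi> y) *v chart_tangent \<Phi> j y)
             else if i = j then 1 else 0)"

definition chart_area ::
    "(real^'n::finite \<Rightarrow> real^'n^'n) \<Rightarrow> 'n set \<Rightarrow> (('n \<Rightarrow> real) \<Rightarrow> real^'n) \<Rightarrow>
     ('n \<Rightarrow> real) set \<Rightarrow> real" where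
  "chart_area g I \<Phi> U =
     (\<integral>y\<in>U. sqrt (det (induced_metric g I \<Phi> y)) \<partial>(\<Pi>\<^sub>M i\<in>I. lborel))"

text \<open>The two open hemispheres \<open>x $ k > 0\<close> and \<open>x $ k < 0\<close> of the sphere of radius \<open>\<rho>\<close> around the
  origin, as graphs over a ball in the coordinate hyperplane \<open>x $ k = 0\<close>.  They cover the sphere up
  to the equator, which has area zero; hence the area below does not depend on the choice of \<open>k\<close>.\<close>

definition hemisphere_domain :: "'n::finite \<Rightarrow> real \<Rightarrow> ('n \<Rightarrow> real) set" where
  "hemisphere_domain k \<rho> = {y \<in> (- {k}) \<rightarrow>\<^sub>E UNIV. (\<Sum>i\<in>- {k}. (y i)\<^sup>2) < \<rho>\<^sup>2}"

definition hemisphere_chart ::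
    "'n::finite \<Rightarrow> real \<Rightarrow> real \<Rightarrow> ('n \<Rightarrow> real) \<Rightarrow> real^'n" where
  "hemisphere_chart k s \<rho> y =
     (\<chi> i. if i = k then s * sqrt (\<rho>\<^sup>2 - (\<Sum>j\<in>- {k}. (y j)\<^sup>2)) else y i)"

definition sphere_area :: "(real^'n::finite \<Rightarrow> real^'n^'n) \<Rightarrow> real \<Rightarrow> real" where
  "sphere_area g \<rho> =
     (let k = (SOME k :: 'n. True) in
      \<Sum>s\<in>{1, -1}. chart_area g (- {k}) (hemisphere_chart k s \<rho>) (hemisphere_domain k \<rho>))"

section \<open>The annulus\<close>

definition annulus :: "real \<Rightarrow> (real^'n::finite) set" where
  "annulus r = ball 0 1 - closure (ball 0 r)"

text \<open>The boundary of \<open>annulus r\<close> is the disjoint union of the spheres of radius 1 and \<open>r\<close>.\<close>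

definition annulus_boundary_area :: "(real^'n::finite \<Rightarrow> real^'n^'n) \<Rightarrow> real \<Rightarrow> real" where
  "annulus_boundary_area g r = sphere_area g 1 + sphere_area g r"

end

theory Submission
  imports Defs
begin

text \<open>
  Metrics $g = u^{4/(n-2)} g_0$ are scalar flat exactly when $u$ is harmonic, because the scalar
  curvature is a negative multiple of $u^{-(n+2)/(n-2)} \<Delta> u$ (\<open>scalar_curvature_conformal_power\<close>).
  Their volume density is $u^{2n/(n-2)}$ and their boundary area density $u^{2(n-1)/(n-2)}$.  For
  $u = 1$ the annulus loses against the ball, but only by a relative volume of $r^n$ and a relative
  boundary area of $r^{n-1}$.

  The better choice is $u = 1 - b + b |x|^{2-n}$ with $b = r^{n-2}$.  It is harmonic, equals 1 on the
  outer sphere and $2 - b$ on the inner one, and is at least 1 in between.  The outer boundary keeps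
  its Euclidean area $n \<omega>$ and the inner one gets an area of at most $16 n \<omega> r^{n-1}$.  Meanwhile $u$
  exceeds 1 by at least $b$ on the ball of radius $1/2$, so the volume is at least
  $\<omega> (1 - r^n + b (2^{-n} - r^n))$ (\<open>metric_volume_lower_bound\<close>).  The fundamental solution thus buys a
  gain of volume of order $r^{n-2}$ at the price of a boundary of order $r^{n-1}$, and for small $r$
  the gain wins (\<open>isoperimetric_comparison\<close>).

  The area of a sphere is given by an integral over charts.  The area element of a hemisphere comes
  from the determinant of $1 + w w^T$ (\<open>det_induced_metric_hemisphere\<close>), and its integral, a radial
  integral over a ball in dimension $n-1$, is evaluated by pushing Lebesgue measure forward under
  $|y|^2$ (\<open>nn_integral_hemisphere\<close>); the outcome is the area $n \<omega> \<rho>^{n-1}$, up to the conformal factor.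
\<close>

section \<open>Partial derivatives and differentiability classes\<close>

lemma partial_eqI: "(f has_derivative f') (at x) \<Longrightarrow> partial i f x = f' (axis i 1)"
  unfolding partial_def by (metis frechet_derivative_at)

lemma has_derivative_frechet:
  "f differentiable (at x) \<Longrightarrow> (f has_derivative frechet_derivative f (at x)) (at x)"
  using frechet_derivative_works by blast

lemma partial_cong:
  assumes "open U" "x \<in> U" "\<And>y. y \<in> U \<Longrightarrow> f y = g y"
  shows "partial i f x = partial i g x"
proof -
  have "(f has_derivative D) (at x) \<longleftrightarrow> (g has_derivative D) (at x)" for D
    using assms has_derivative_transform_within_open[of _ D x UNIV U] by (metis)
  then show ?thesis unfolding partial_def frechet_derivative_def by simp
qed

lemma differentiable_cong_open:
  assumes "open U" "x \<in> U" "\<And>y. y \<in> U \<Longrightarrow> f y = g y" "f differentiable (at x)"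
  shows "g differentiable (at x)"
  using assms has_derivative_transform_within_open[of f _ x UNIV U g]
  unfolding differentiable_def by blast

lemma partial_const [simp]: "partial i (\<lambda>x. c) x = 0"
  by (subst partial_eqI[OF has_derivative_const]) auto

lemma partial_component [simp]:
  fixes x :: "real^'n::finite"
  shows "partial i (\<lambda>x. x $ j) x = (if i = j then 1 else 0)"
proof -
  have "((\<lambda>x::real^'n. x $ j) has_derivative (\<lambda>h. h $ j)) (at x)"
    by (intro bounded_linear_imp_has_derivative bounded_linear_vec_nth)
  from partial_eqI[OF this] show ?thesis by (auto simp: axis_def)
qed

lemma differentiable_component: "(\<lambda>x::real^'n::finite. x $ j) differentiable (at x)"
  unfolding differentiable_def
  using bounded_linear_imp_has_derivative[OF bounded_linear_vec_nth] by blast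

lemma partial_add:
  assumes "f differentiable (at x)" "g differentiable (at x)"
  shows "partial i (\<lambda>x. f x + g x) x = partial i f x + partial i g x"
  by (subst partial_eqI[OF has_derivative_add[OF has_derivative_frechet has_derivative_frechet]])
     (use assms in \<open>auto simp: partial_def\<close>)

lemma partial_mult:
  assumes "f differentiable (at x)" "g differentiable (at x)"
  shows "partial i (\<lambda>x. f x * g x) x = f x * partial i g x + partial i f x * g x"
  by (subst partial_eqI[OF has_derivative_mult[OF has_derivative_frechet has_derivative_frechet]])
     (use assms in \<open>auto simp: partial_def\<close>)

lemma partial_cmult:
  assumes "f differentiable (at x)"
  shows "partial i (\<lambda>x. c * f x) x = c * partial i f x"
  by (subst partial_mult) (use assms in auto)

lemma partial_diff:
  assumes "f differentiable (at x)" "g differentiable (at x)"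
  shows "partial i (\<lambda>x. f x - g x) x = partial i f x - partial i g x"
  by (subst partial_eqI[OF has_derivative_diff[OF has_derivative_frechet has_derivative_frechet]])
     (use assms in \<open>auto simp: partial_def\<close>)

lemma has_derivative_powr_const:
  fixes f :: "real^'n::finite \<Rightarrow> real"
  assumes "f differentiable (at x)" "f x > 0"
  shows "((\<lambda>x. f x powr a) has_derivative
           (\<lambda>h. a * f x powr (a - 1) * frechet_derivative f (at x) h)) (at x)"
  using has_derivative_powr[OF has_derivative_frechet[OF assms(1)] has_derivative_const, of a] assms(2)
  by (simp add: powr_diff mult_ac)

lemma differentiable_powr_const:
  fixes f :: "real^'n::finite \<Rightarrow> real"
  assumes "f differentiable (at x)" "f x > 0"
  shows "(\<lambda>x. f x powr a) differentiable (at x)"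
  using has_derivative_powr_const[OF assms] unfolding differentiable_def by blast

lemma partial_powr:
  assumes "f differentiable (at x)" "f x > 0"
  shows "partial i (\<lambda>x. f x powr a) x = a * f x powr (a - 1) * partial i f x"
  by (subst partial_eqI[OF has_derivative_powr_const[OF assms]]) (simp add: partial_def)

text \<open>\<^const>\<open>partial\<close> sees only the germ of a function, so on an open set \<^const>\<open>C_diff\<close> may be
  checked on any function that agrees there; this is what lets the closure properties below replace
  a partial derivative by its computed formula.\<close>
lemma C_diff_cong:
  assumes "open U" "\<And>x. x \<in> U \<Longrightarrow> f x = g x"
  shows "C_diff k U f \<longleftrightarrow> C_diff k U g"
  using assms(2)
proof (induction k arbitrary: f g)
  case 0
  then show ?case by (simp cong: continuous_on_cong)
next
  case (Suc k)
  have "f differentiable (at x) \<longleftrightarrow> g differentiable (at x)" if "x \<in> U" for x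
    using differentiable_cong_open[OF assms(1) that, of f g]
      differentiable_cong_open[OF assms(1) that, of g f] Suc.prems by auto
  moreover have "C_diff k U (partial i f) \<longleftrightarrow> C_diff k U (partial i g)" for i
    by (rule Suc.IH) (use partial_cong[OF assms(1)] Suc.prems in blast)
  ultimately show ?case by simp
qed

lemma C_diff_continuous_on: "C_diff k U f \<Longrightarrow> continuous_on U f"
  by (cases k)
     (auto intro: continuous_at_imp_continuous_on differentiable_imp_continuous_within)

lemma C_diff_differentiable: "C_diff (Suc k) U f \<Longrightarrow> x \<in> U \<Longrightarrow> f differentiable (at x)"
  by simp

lemma C_diff_SucD: "C_diff (Suc k) U f \<Longrightarrow> C_diff k U f"
proof (induction k arbitrary: f)
  case 0
  then show ?case using C_diff_continuous_on[OF 0] by simp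
next
  case (Suc k)
  have "C_diff k U (partial i f)" for i
    by (rule Suc.IH) (use Suc.prems in simp)
  then show ?case using Suc.prems by simp
qed

lemma C_diff_const: "C_diff k U (\<lambda>x. c)"
proof (induction k arbitrary: c)
  case (Suc k)
  have "partial i (\<lambda>x. c) = (\<lambda>x. 0)" for i :: 'a by auto
  then show ?case using Suc by simp
qed auto

lemma C_diff_component: "C_diff k U (\<lambda>x. x $ j)"
proof (cases k)
  case (Suc l)
  have "partial i (\<lambda>x. x $ j) = (\<lambda>x. if i = j then 1 else 0)" for i :: 'a by auto
  then show ?thesis using Suc by (simp add: differentiable_component C_diff_const)
qed (auto intro: continuous_intros)

lemma C_diff_add:
  assumes "open U" "C_diff k U f" "C_diff k U g"
  shows "C_diff k U (\<lambda>x. f x + g x)"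
  using assms(2,3)
proof (induction k arbitrary: f g)
  case (Suc k)
  have "C_diff k U (partial i (\<lambda>x. f x + g x))" for i
  proof (subst C_diff_cong[OF assms(1), where g="\<lambda>x. partial i f x + partial i g x"])
    show "partial i (\<lambda>x. f x + g x) x = partial i f x + partial i g x" if "x \<in> U" for x
      by (rule partial_add) (use Suc.prems that in auto)
  qed (use Suc in auto)
  then show ?case using Suc.prems by simp
qed (auto intro: continuous_intros)

text \<open>By the product rule a partial derivative of \<open>f * g\<close> involves \<open>f\<close> and \<open>g\<close> themselves as well as
  their partial derivatives, so the induction needs that the classes decrease with the order,
  \<open>C_diff_SucD\<close>, to lower the order of \<open>f\<close> and \<open>g\<close>.\<close>
lemma C_diff_mult:
  assumes "open U" "C_diff k U f" "C_diff k U g"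
  shows "C_diff k U (\<lambda>x. f x * g x)"
  using assms(2,3)
proof (induction k arbitrary: f g)
  case (Suc k)
  have "C_diff k U (partial i (\<lambda>x. f x * g x))" for i
  proof (subst C_diff_cong[OF assms(1), where g="\<lambda>x. f x * partial i g x + partial i f x * g x"])
    show "partial i (\<lambda>x. f x * g x) x = f x * partial i g x + partial i f x * g x" if "x \<in> U" for x
      by (rule partial_mult) (use Suc.prems that in auto)
    show "C_diff k U (\<lambda>x. f x * partial i g x + partial i f x * g x)"
      by (intro C_diff_add[OF assms(1)] Suc.IH)
         (use Suc.prems C_diff_SucD[OF Suc.prems(1)] C_diff_SucD[OF Suc.prems(2)] in auto)
  qed
  then show ?case using Suc.prems by simp
qed (auto intro: continuous_intros)

lemma C_diff_sum:
  assumes "open U" "finite K" "\<And>j. j \<in> K \<Longrightarrow> C_diff k U (f j)"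
  shows "C_diff k U (\<lambda>x. \<Sum>j\<in>K. f j x)"
  using assms(2,3) by (induction K rule: finite_induct) (auto intro: C_diff_const C_diff_add[OF assms(1)])

text \<open>The exponent is generalized in the induction because differentiation lowers it by one.\<close>
lemma C_diff_powr:
  assumes "open U" "\<And>x. x \<in> U \<Longrightarrow> f x > 0" "C_diff k U f"
  shows "C_diff k U (\<lambda>x. f x powr a)"
  using assms(3)
proof (induction k arbitrary: a)
  case 0
  then show ?case using assms(2) by (force intro!: continuous_intros)
next
  case (Suc k)
  have "C_diff k U (partial i (\<lambda>x. f x powr a))" for i
  proof (subst C_diff_cong[OF assms(1), where g="\<lambda>x. a * f x powr (a - 1) * partial i f x"])
    show "partial i (\<lambda>x. f x powr a) x = a * f x powr (a - 1) * partial i f x" if "x \<in> U" for x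
      by (rule partial_powr) (use Suc.prems assms(2) that in auto)
    show "C_diff k U (\<lambda>x. a * f x powr (a - 1) * partial i f x)"
      by (intro C_diff_mult[OF assms(1)] C_diff_const Suc.IH)
         (use Suc.prems C_diff_SucD[OF Suc.prems] in auto)
  qed
  moreover have "(\<lambda>x. f x powr a) differentiable (at x)" if "x \<in> U" for x
    by (rule differentiable_powr_const) (use Suc.prems assms(2) that in auto)
  ultimately show ?case by simp
qed

lemma smooth_on_powr:
  assumes "\<And>k. C_diff k U f" "open U" "S \<subseteq> U" "\<And>x. x \<in> U \<Longrightarrow> f x > 0"
  shows "smooth_on S (\<lambda>x. f x powr a)"
  unfolding smooth_on_def using C_diff_powr[OF assms(2,4,1)] assms(2,3) by blast

section \<open>Curvature of conformally flat metrics\<close>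

lemma riemannian_metric_on_conformally_flat:
  fixes \<phi> :: "real^'n::finite \<Rightarrow> real"
  assumes sm: "smooth_on S \<phi>" and pos: "\<And>x. x \<in> S \<Longrightarrow> \<phi> x > 0"
  shows "riemannian_metric_on S (\<lambda>x. \<phi> x *\<^sub>R flat_metric x)"
  unfolding riemannian_metric_on_def
proof (intro conjI allI ballI impI)
  fix i j :: 'n
  from sm obtain U h where h: "open U" "S \<subseteq> U" "\<forall>k. C_diff k U h" "\<forall>x\<in>S. h x = \<phi> x"
    unfolding smooth_on_def by blast
  show "smooth_on S (\<lambda>x. (\<phi> x *\<^sub>R flat_metric x :: real^'n^'n) $ i $ j)"
    unfolding smooth_on_def
    by (intro exI[of _ U] exI[of _ "\<lambda>x. h x * (if i = j then 1 else 0)"])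
       (use h in \<open>auto simp: flat_metric_def mat_def intro!: C_diff_mult C_diff_const\<close>)
next
  fix x assume "x \<in> S"
  show "transpose (\<phi> x *\<^sub>R flat_metric x) = \<phi> x *\<^sub>R (flat_metric x :: real^'n^'n)"
    by (simp add: flat_metric_def transpose_def mat_def vec_eq_iff)
  show "v \<bullet> ((\<phi> x *\<^sub>R flat_metric x) *v v) > 0" if "v \<noteq> 0" for v :: "real^'n"
    using pos[OF \<open>x \<in> S\<close>] that
    by (simp add: flat_metric_def flip: scaleR_matrix_vector_assoc)
qed

lemma matrix_inv_scaled_mat:
  assumes "c \<noteq> (0::real)"
  shows "matrix_inv (c *\<^sub>R (mat 1 :: real^'n^'n)) = (1 / c) *\<^sub>R mat 1"
proof -
  let ?A = "c *\<^sub>R (mat 1 :: real^'n^'n)" and ?B = "(1 / c) *\<^sub>R (mat 1 :: real^'n^'n)"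
  have AB: "?A ** ?B = mat 1" "?B ** ?A = mat 1"
    using assms by (simp_all add: matrix_scalar_ac scalar_matrix_assoc flip: scalar_mult_eq_scaleR)
  have "?A ** matrix_inv ?A = mat 1 \<and> matrix_inv ?A ** ?A = mat 1"
    unfolding matrix_inv_def by (rule someI[of _ ?B]) (use AB in auto)
  then have "?B ** (?A ** matrix_inv ?A) = ?B" by simp
  then show ?thesis by (simp add: matrix_mul_assoc AB)
qed

text \<open>It is convenient to describe the conformal factor by the logarithmic gradient
  $p_i = (1/2) \<partial>_i log \<phi>$: in terms of $p$ the Christoffel symbols
  $\<delta>_{jk} p_i + \<delta>_{ik} p_j - \<delta>_{ij} p_k$ are linear and free of $\<phi>$.\<close>
lemma christoffel_conformally_flat:
  fixes \<phi> :: "real^'n::finite \<Rightarrow> real" and p :: "'n \<Rightarrow> real^'n \<Rightarrow> real"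
  assumes "\<phi> x > 0" "\<phi> differentiable (at x)" "\<And>i. partial i \<phi> x = 2 * \<phi> x * p i x"
  shows "christoffel (\<lambda>x. \<phi> x *\<^sub>R flat_metric x) k i j x =
     (if j = k then p i x else 0) + (if i = k then p j x else 0) - (if i = j then p k x else 0)"
proof -
  define g where "g = (\<lambda>x. \<phi> x *\<^sub>R (flat_metric x :: real^'n^'n))"
  have inv: "matrix_inv (g x) $ k $ l = (if k = l then 1 / \<phi> x else 0)" for l
    using assms(1) by (simp add: g_def flat_metric_def matrix_inv_scaled_mat) (simp add: mat_def)
  have part: "partial i (\<lambda>y. g y $ a $ b) x = (if a = b then 2 * \<phi> x * p i x else 0)" for i a b
  proof -
    have "(\<lambda>y. g y $ a $ b) = (\<lambda>y. \<phi> y * (if a = b then 1 else 0))"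
      by (auto simp: g_def flat_metric_def mat_def)
    then show ?thesis using assms(2,3) by (auto simp: partial_mult)
  qed
  have "christoffel g k i j x = (1/2) * (1 / \<phi> x * ((if j = k then 2 * \<phi> x * p i x else 0)
      + (if i = k then 2 * \<phi> x * p j x else 0) - (if i = j then 2 * \<phi> x * p k x else 0)))"
    unfolding christoffel_def inv part by (simp add: if_distrib[of "\<lambda>t. t * _"] cong: if_cong)
  also have "\<dots> = (if j = k then p i x else 0) + (if i = k then p j x else 0) - (if i = j then p k x else 0)"
    using assms(1) by (simp add: field_simps)
  finally show ?thesis unfolding g_def .
qed

text \<open>Only the diagonal of the Ricci tensor enters the trace.  With $D = \<Sum>_k \<partial>_k p_k$ and
  $P = |p|^2$ it is $R_{ii} = (2-n) \<partial>_i p_i - D + (n-2) p_i^2 - (n-2) P$, and summing over $i$ gives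
  $-(n-1)(2D + (n-2)P)$; the inverse metric contributes the factor $1/\<phi>$.\<close>
lemma scalar_curvature_conformally_flat:
  fixes \<phi> :: "real^'n::finite \<Rightarrow> real" and p :: "'n \<Rightarrow> real^'n \<Rightarrow> real"
  assumes "open U" "x \<in> U"
    and pos: "\<And>y. y \<in> U \<Longrightarrow> \<phi> y > 0" and diff: "\<And>y. y \<in> U \<Longrightarrow> \<phi> differentiable (at y)"
    and grad: "\<And>y i. y \<in> U \<Longrightarrow> partial i \<phi> y = 2 * \<phi> y * p i y"
    and pdiff: "\<And>i. p i differentiable (at x)"
  shows "scalar_curvature (\<lambda>x. \<phi> x *\<^sub>R flat_metric x) x =
     - (real CARD('n) - 1) / \<phi> x *
       (2 * (\<Sum>i\<in>UNIV. partial i (p i) x) + (real CARD('n) - 2) * (\<Sum>i\<in>UNIV. (p i x)\<^sup>2))"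
proof -
  define g where "g = (\<lambda>x. \<phi> x *\<^sub>R (flat_metric x :: real^'n^'n))"
  define n where "n = real CARD('n)"
  define D where "D = (\<Sum>i\<in>UNIV. partial i (p i) x)"
  define P where "P = (\<Sum>i\<in>UNIV. (p i x)\<^sup>2)"
  have Gam: "christoffel g k i j y =
     (if j = k then p i y else 0) + (if i = k then p j y else 0) - (if i = j then p k y else 0)"
    if "y \<in> U" for k i j y
    unfolding g_def by (rule christoffel_conformally_flat) (use pos diff grad that in auto)
  have Gam_kk: "christoffel g k k l x = p l x" "christoffel g l i i x = (if i = l then 2 * p i x else 0) - p l x"
    for k l i using Gam[OF assms(2)] by auto
  have d1: "partial k (christoffel g k i i) x = (if i = k then 2 * partial i (p i) x else 0) - partial k (p k) x"
    for i k
  proof -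
    have "partial k (christoffel g k i i) x = partial k (\<lambda>y. (if i = k then 2 else 0) * p i y - p k y) x"
      by (rule partial_cong[OF assms(1,2)]) (auto simp: Gam)
    also have "\<dots> = (if i = k then 2 * partial i (p i) x else 0) - partial k (p k) x"
      using pdiff by (auto simp: partial_diff partial_cmult)
    finally show ?thesis .
  qed
  have d2: "partial i (christoffel g k i k) x = partial i (p i) x" for i k
    by (rule partial_cong[OF assms(1,2)]) (auto simp: Gam)
  have q1: "(\<Sum>k\<in>UNIV. \<Sum>l\<in>UNIV. christoffel g k k l x * christoffel g l i i x) = n * (2 * (p i x)\<^sup>2 - P)" for i
  proof -
    have "(\<Sum>l\<in>UNIV. christoffel g k k l x * christoffel g l i i x) = 2 * (p i x)\<^sup>2 - P" for k
      unfolding Gam_kk P_def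
      by (simp add: right_diff_distrib sum_subtractf if_distrib[of "\<lambda>t. _ * t"] power2_eq_square cong: if_cong)
    then show ?thesis by (simp add: n_def)
  qed
  \<comment> \<open>With $a = \<delta>_{kl} p_i$ and $b = \<delta>_{ik} p_l - \<delta>_{il} p_k$ the two factors are $a + b$ and $a - b$.\<close>
  have q2: "(\<Sum>k\<in>UNIV. \<Sum>l\<in>UNIV. christoffel g k i l x * christoffel g l i k x) =
      n * (p i x)\<^sup>2 - 2 * P + 2 * (p i x)\<^sup>2" for i
  proof -
    have "christoffel g k i l x * christoffel g l i k x =
       (if l = k then (p i x)\<^sup>2 else 0) - (if i = k then (p l x)\<^sup>2 else 0) - (if i = l then (p k x)\<^sup>2 else 0)
        + (if i = k then (if i = l then 2 * p k x * p l x else 0) else 0)" for k l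
      unfolding Gam[OF assms(2)] by (auto simp: algebra_simps power2_eq_square)
    then have "(\<Sum>l\<in>UNIV. christoffel g k i l x * christoffel g l i k x) =
      (p i x)\<^sup>2 - (if i = k then P else 0) - (p k x)\<^sup>2 + (if i = k then 2 * p k x * p i x else 0)" for k
      by (cases "i = k") (simp_all add: sum.distrib sum_subtractf P_def)
    then show ?thesis by (simp add: sum.distrib sum_subtractf P_def n_def power2_eq_square)
  qed
  have ric: "ricci g i i x = (2 - n) * partial i (p i) x - D + (n - 2) * (p i x)\<^sup>2 - (n - 2) * P" for i
    unfolding ricci_def sum_subtractf q1 q2 d1 d2
    by (simp add: D_def[symmetric]) (simp add: n_def algebra_simps)
  have inv: "matrix_inv (g x) $ i $ j = (if i = j then 1 / \<phi> x else 0)" for i j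
    using pos[OF assms(2)] by (simp add: g_def flat_metric_def matrix_inv_scaled_mat) (simp add: mat_def)
  have "scalar_curvature g x = (\<Sum>i\<in>UNIV. ricci g i i x) / \<phi> x"
    unfolding scalar_curvature_def inv
    by (simp add: if_distrib[of "\<lambda>t. t * _"] sum_divide_distrib cong: if_cong)
  also have "(\<Sum>i\<in>UNIV. ricci g i i x) = (2 - n) * D - n * D + (n - 2) * P - n * ((n - 2) * P)"
    unfolding ric by (simp add: sum.distrib sum_subtractf D_def P_def n_def flip: sum_distrib_left)
  also have "\<dots> = - (n - 1) * (2 * D + (n - 2) * P)" by (simp add: algebra_simps)
  finally show ?thesis unfolding g_def D_def P_def n_def by simp
qed

text \<open>The Yamabe equation for a flat background.  The exponent $4/(n-2)$ is the one for which the terms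
  quadratic in the gradient of $u$ cancel, leaving a multiple of the Laplacian: the metric is
  scalar flat exactly where $u$ is harmonic.\<close>
lemma scalar_curvature_conformal_power:
  fixes u :: "real^'n::finite \<Rightarrow> real"
  assumes n: "CARD('n) \<ge> 3" and U: "open U" "x \<in> U"
    and pos: "\<And>y. y \<in> U \<Longrightarrow> u y > 0" and diff: "C_diff 2 U u"
  defines "n \<equiv> real CARD('n)"
  shows "scalar_curvature (\<lambda>x. u x powr (4 / (n - 2)) *\<^sub>R flat_metric x) x =
     - 4 * (n - 1) / (n - 2) * u x powr (- (n + 2) / (n - 2)) * (\<Sum>i\<in>UNIV. partial i (partial i u) x)"
proof -
  have n3: "n \<ge> 3" using n by (simp add: n_def)
  define L where "L = (\<Sum>i\<in>UNIV. partial i (partial i u) x)"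
  define Q where "Q = (\<Sum>i\<in>UNIV. (partial i u x)\<^sup>2)"
  define p where "p = (\<lambda>i y. 2 / (n - 2) * (partial i u y * u y powr (-1)))"
  have ud: "u differentiable (at y)" "partial i u differentiable (at y)" if "y \<in> U" for y i
    using diff that by (auto simp: numeral_2_eq_2)
  have ux: "u x > 0" using pos U by auto
  have pd: "(\<lambda>y. partial i u y * u y powr (-1)) differentiable (at x)" for i
    by (intro differentiable_mult differentiable_powr_const ud U ux)
  have "partial i (p i) x = 2 / (n - 2) * (partial i (partial i u) x / u x - (partial i u x)\<^sup>2 / (u x)\<^sup>2)" for i
  proof -
    have "partial i (p i) x = 2 / (n - 2) * partial i (\<lambda>y. partial i u y * u y powr (-1)) x"
      unfolding p_def by (rule partial_cmult[OF pd])
    also have "partial i (\<lambda>y. partial i u y * u y powr (-1)) x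
      = partial i u x * (- 1 * u x powr (- 1 - 1) * partial i u x) + partial i (partial i u) x * u x powr (-1)"
      unfolding partial_mult[OF ud(2)[OF U(2)] differentiable_powr_const[OF ud(1)[OF U(2)] ux]]
        partial_powr[OF ud(1)[OF U(2)] ux] ..
    also have "\<dots> = partial i (partial i u) x / u x - (partial i u x)\<^sup>2 / (u x)\<^sup>2"
      using ux by (simp add: powr_minus_divide powr_diff power2_eq_square field_simps)
    finally show ?thesis .
  qed
  then have D: "(\<Sum>i\<in>UNIV. partial i (p i) x) = 2 / (n - 2) * (L / u x - Q / (u x)\<^sup>2)"
    by (simp add: L_def Q_def sum_subtractf flip: sum_divide_distrib sum_distrib_left)
  have P: "(\<Sum>i\<in>UNIV. (p i x)\<^sup>2) = (2 / (n - 2))\<^sup>2 * (Q / (u x)\<^sup>2)"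
    unfolding Q_def p_def sum_divide_distrib sum_distrib_left
    using ux by (intro sum.cong refl) (simp add: powr_minus_divide power_mult_distrib power_divide)
  have "scalar_curvature (\<lambda>x. u x powr (4 / (n - 2)) *\<^sub>R flat_metric x) x =
     - (n - 1) / u x powr (4 / (n - 2)) * (2 * (\<Sum>i\<in>UNIV. partial i (p i) x) + (n - 2) * (\<Sum>i\<in>UNIV. (p i x)\<^sup>2))"
    unfolding n_def
  proof (rule scalar_curvature_conformally_flat[OF U])
    show "partial i (\<lambda>x. u x powr (4 / (real CARD('n) - 2))) y =
        2 * u y powr (4 / (real CARD('n) - 2)) * p i y" if "y \<in> U" for y i
      using pos[OF that] n3
      by (simp add: partial_powr[OF ud(1)[OF that] pos[OF that]] p_def powr_minus_divide powr_diff flip: n_def)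
  next
    show "p i differentiable (at x)" for i
      unfolding p_def by (intro differentiable_mult differentiable_const pd)
  next
    show "u y powr (4 / (real CARD('n) - 2)) > 0" if "y \<in> U" for y
      using pos[OF that] by simp
  qed (use pos ud in \<open>auto intro: differentiable_powr_const\<close>)
  also have "2 * (\<Sum>i\<in>UNIV. partial i (p i) x) + (n - 2) * (\<Sum>i\<in>UNIV. (p i x)\<^sup>2) = 4 / (n - 2) * L / u x"
  proof -
    have "2 * (2 / m * (L / u x - Q / (u x)\<^sup>2)) + m * ((2 / m)\<^sup>2 * (Q / (u x)\<^sup>2)) = 4 / m * L / u x"
      if "m \<noteq> 0" for m
      using that ux by (simp add: power_divide power2_eq_square right_diff_distrib)
    from this[of "n - 2"] show ?thesis unfolding D P using n3 by simp
  qed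
  also have "- (n - 1) / u x powr (4 / (n - 2)) * (4 / (n - 2) * L / u x)
      = - 4 * (n - 1) / (n - 2) * (1 / (u x powr (4 / (n - 2)) * u x powr 1)) * L"
    using ux n3 by (simp add: algebra_simps)
  also have "1 / (u x powr (4 / (n - 2)) * u x powr 1) = u x powr (- (n + 2) / (n - 2))"
  proof -
    have "4 / (n - 2) + 1 = (n + 2) / (n - 2)" using n3 by (simp add: field_simps)
    then show ?thesis by (metis powr_add minus_divide_left powr_minus_divide)
  qed
  finally show ?thesis unfolding L_def .
qed

section \<open>The harmonic conformal factor\<close>

lemma C_diff_inner_self: "C_diff k U (\<lambda>x::real^'n::finite. x \<bullet> x)" if "open U"
  unfolding inner_vec_def inner_real_def by (intro C_diff_sum C_diff_mult C_diff_component that) simp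

lemma partial_inner_self:
  fixes x :: "real^'n::finite"
  shows "partial i (\<lambda>x. x \<bullet> x) x = 2 * x $ i"
  by (subst partial_eqI[OF has_derivative_inner[OF has_derivative_ident has_derivative_ident]])
     (simp add: inner_axis inner_commute)

lemma partial_radial_power:
  fixes x :: "real^'n::finite"
  assumes "x \<noteq> 0"
  shows "partial i (\<lambda>x. (x \<bullet> x) powr a) x = 2 * a * ((x \<bullet> x) powr (a - 1) * x $ i)"
proof -
  have "(\<lambda>x::real^'n. x \<bullet> x) differentiable (at x)"
    by (rule C_diff_differentiable[OF C_diff_inner_self[of UNIV 1, simplified One_nat_def]]) auto
  from partial_powr[OF this, of i a] assms show ?thesis by (simp add: partial_inner_self)
qed

text \<open>For $|x|^{2a}$ the radial and angular contributions combine to the factor $n + 2a - 2$, which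
  vanishes for the exponent of the fundamental solution.\<close>
lemma laplacian_radial_power:
  fixes x :: "real^'n::finite"
  assumes "x \<noteq> 0"
  shows "(\<Sum>i\<in>UNIV. partial i (partial i (\<lambda>x. (x \<bullet> x) powr a)) x) =
    2 * a * (real CARD('n) + 2 * a - 2) * (x \<bullet> x) powr (a - 1)"
proof -
  let ?U = "- {0::real^'n}"
  have U: "open ?U" "x \<in> ?U" using assms by (auto intro: open_Compl)
  have d: "(\<lambda>x::real^'n. (x \<bullet> x) powr b) differentiable (at x)" for b
    by (rule C_diff_differentiable[of 0 ?U], rule C_diff_powr) (use U C_diff_inner_self[OF U(1)] in \<open>auto simp del: C_diff.simps\<close>)
  have "partial i (partial i (\<lambda>x. (x \<bullet> x) powr a)) x =
      2 * a * ((x \<bullet> x) powr (a - 1) + 2 * (a - 1) * (x \<bullet> x) powr (a - 1) * ((x $ i)\<^sup>2 / (x \<bullet> x)))" for i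
  proof -
    have "partial i (partial i (\<lambda>x. (x \<bullet> x) powr a)) x = partial i (\<lambda>x. 2 * a * ((x \<bullet> x) powr (a - 1) * x $ i)) x"
      by (rule partial_cong[OF U]) (simp add: partial_radial_power)
    also have "\<dots> = 2 * a * partial i (\<lambda>x. (x \<bullet> x) powr (a - 1) * x $ i) x"
      by (intro partial_cmult differentiable_mult d differentiable_component)
    also have "partial i (\<lambda>x. (x \<bullet> x) powr (a - 1) * x $ i) x =
        (x \<bullet> x) powr (a - 1) * 1 + 2 * (a - 1) * ((x \<bullet> x) powr (a - 1 - 1) * x $ i) * x $ i"
      by (simp add: partial_mult[OF d differentiable_component] partial_radial_power[OF assms])
    also have "(x \<bullet> x) powr (a - 1 - 1) = (x \<bullet> x) powr (a - 1) / (x \<bullet> x)"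
      using assms by (simp only: powr_diff[of _ "a - 1" 1]) simp
    finally show ?thesis by (simp add: power2_eq_square algebra_simps diff_divide_distrib)
  qed
  then have "(\<Sum>i\<in>UNIV. partial i (partial i (\<lambda>x. (x \<bullet> x) powr a)) x) =
      2 * a * (real CARD('n) * (x \<bullet> x) powr (a - 1)
        + 2 * (a - 1) * (x \<bullet> x) powr (a - 1) * ((\<Sum>i\<in>UNIV. (x $ i)\<^sup>2) / (x \<bullet> x)))"
    by (simp add: sum.distrib flip: sum_distrib_left sum_divide_distrib)
  also have "(\<Sum>i\<in>UNIV. (x $ i)\<^sup>2) = x \<bullet> x" by (simp add: inner_vec_def power2_eq_square)
  finally show ?thesis using assms by (simp add: algebra_simps)
qed

text \<open>An affine combination of 1 and the fundamental solution $|x|^{2-n}$ of the Laplacian, both of which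
  are 1 on the unit sphere.  The norm is written as a power of the inner product, which is smooth
  off the origin.\<close>
definition green_factor :: "real \<Rightarrow> real^'n::finite \<Rightarrow> real" where
  "green_factor b x = 1 - b + b * (x \<bullet> x) powr ((2 - real CARD('n)) / 2)"

lemma green_factor_pos:
  fixes x :: "real^'n::finite"
  assumes "0 \<le> b" "b < 1"
  shows "green_factor b x > 0"
proof -
  have "0 \<le> b * (x \<bullet> x) powr ((2 - real CARD('n)) / 2)" using assms by simp
  then show ?thesis unfolding green_factor_def using assms by linarith
qed

lemma C_diff_green_factor: "C_diff k (- {0}) (green_factor b)"
proof -
  have U: "open (- {0::real^'n})" by (auto intro: open_Compl)
  show ?thesis unfolding green_factor_def[abs_def]
    by (intro C_diff_add C_diff_mult C_diff_const C_diff_powr C_diff_inner_self U) auto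
qed

lemma laplacian_green_factor:
  fixes x :: "real^'n::finite"
  assumes "x \<noteq> 0"
  shows "(\<Sum>i\<in>UNIV. partial i (partial i (green_factor b)) x) = 0"
proof -
  let ?U = "- {0::real^'n}" and ?a = "(2 - real CARD('n)) / 2"
  let ?w = "\<lambda>x::real^'n. (x \<bullet> x) powr ?a"
  have U: "open ?U" "x \<in> ?U" using assms by (auto intro: open_Compl)
  have w: "C_diff k ?U ?w" for k by (rule C_diff_powr) (use U C_diff_inner_self in auto)
  have d: "?w differentiable (at y)" "partial i ?w differentiable (at y)" if "y \<noteq> 0" for y i
    using w[of 2] that by (simp_all add: numeral_2_eq_2)
  have 1: "partial i (green_factor b) y = b * partial i ?w y" if "y \<noteq> 0" for y :: "real^'n" and i
    unfolding green_factor_def[abs_def]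
    by (subst partial_add) (use d[OF that] in \<open>auto intro!: differentiable_mult simp: partial_cmult\<close>)
  have "partial i (partial i (green_factor b)) x = b * partial i (partial i ?w) x" for i
  proof -
    have "partial i (partial i (green_factor b)) x = partial i (\<lambda>y. b * partial i ?w y) x"
      by (rule partial_cong[OF U]) (simp add: 1)
    then show ?thesis by (simp add: partial_cmult[OF d(2)[OF assms]])
  qed
  then have "(\<Sum>i\<in>UNIV. partial i (partial i (green_factor b)) x) = b * (\<Sum>i\<in>UNIV. partial i (partial i ?w) x)"
    by (simp add: sum_distrib_left)
  also have "real CARD('n) + 2 * ?a - 2 = 0" by (simp add: field_simps)
  then have "(\<Sum>i\<in>UNIV. partial i (partial i ?w) x) = 0"
    unfolding laplacian_radial_power[OF assms] by (simp del: divide_eq_0_iff)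
  finally show ?thesis by simp
qed

lemma green_factor_eq_norm:
  fixes x :: "real^'n::finite"
  assumes "x \<noteq> 0"
  shows "green_factor b x = 1 - b + b * norm x powr (2 - real CARD('n))"
proof -
  have "x \<bullet> x = norm x powr 2" using assms by (simp add: dot_square_norm)
  then have "(x \<bullet> x) powr (a / 2) = norm x powr a" for a
    by (simp only: powr_powr) simp
  then show ?thesis by (simp add: green_factor_def)
qed

text \<open>Here $n \<ge> 3$ gives $|x|^{2-n} \<ge> |x|^{-1} \<ge> 2$ on the ball of radius $1/2$.\<close>
lemma green_factor_lower_bound:
  fixes x :: "real^'n::finite"
  assumes n: "CARD('n) \<ge> 3" and b: "0 \<le> b" and x: "x \<noteq> 0" "norm x \<le> 1"
  shows "green_factor b x \<ge> 1 + b * indicator (cball 0 (1/2)) x"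
proof -
  have "norm x powr (2 - real CARD('n)) \<ge> 1 + indicator (cball 0 (1/2)) x"
  proof (cases "norm x \<le> 1/2")
    case True
    have "(1/2::real) powr (-1) \<le> (1/2) powr (2 - real CARD('n))"
      using n by (intro powr_mono') auto
    also have "\<dots> \<le> norm x powr (2 - real CARD('n))"
      using True x n by (intro powr_mono2') auto
    finally show ?thesis using True by (simp add: powr_minus)
  next
    case False
    have "1 powr (2 - real CARD('n)) \<le> norm x powr (2 - real CARD('n))"
      using x n by (intro powr_mono2') auto
    then show ?thesis using False by simp
  qed
  from mult_left_mono[OF this b] show ?thesis
    unfolding green_factor_eq_norm[OF x(1)] by (simp add: algebra_simps)
qed

section \<open>Area of spheres\<close>

definition outer_square :: "real^'n::finite \<Rightarrow> real^'n^'n" where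
  "outer_square v = (\<chi> i j. v $ i * v $ j)"

lemma outer_square_conjugate:
  "M ** outer_square v ** transpose M = outer_square (M *v v)"
  by (simp add: vec_eq_iff outer_square_def matrix_matrix_mult_def transpose_def
      matrix_vector_mult_def sum_product sum_distrib_left sum_distrib_right mult_ac)

lemma add_matrix_mul:
  fixes A B :: "'a::semiring_1^'n^'m"
  shows "(A + B) ** C = A ** C + B ** C"
  by (simp add: vec_eq_iff matrix_matrix_mult_def distrib_right sum.distrib)

text \<open>The matrix determinant lemma in the symmetric case: an orthogonal change of basis moves $v$ to
  $|v|$ times a basis vector, and then the matrix is diagonal.\<close>
lemma det_mat1_plus_outer_square:
  fixes v :: "real^'n::finite"
  shows "det (mat 1 + outer_square v) = 1 + v \<bullet> v"
proof -
  obtain k :: 'n where True by blast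
  have "norm v = norm (norm v *\<^sub>R axis k (1::real))" by (simp add: norm_axis_1)
  then obtain f :: "real^'n \<Rightarrow> real^'n" where f: "orthogonal_transformation f" "f v = norm v *\<^sub>R axis k 1"
    by (rule orthogonal_transformation_exists) (rule that)
  define M where "M = matrix f"
  have lin: "linear f" and M: "orthogonal_matrix M"
    using f(1) by (simp_all add: orthogonal_transformation_matrix M_def)
  have Mv: "M *v v = norm v *\<^sub>R axis k 1"
    using f(2) lin by (simp add: M_def matrix_works)
  have MM: "M ** transpose M = mat 1" using M by (simp add: orthogonal_matrix_def)
  have "det (M ** (mat 1 + outer_square v) ** transpose M) = det (mat 1 + outer_square v) * det (M ** transpose M)"
    by (simp add: det_mul)
  then have "det (mat 1 + outer_square v) = det (M ** (mat 1 + outer_square v) ** transpose M)"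
    by (simp add: MM)
  also have "M ** (mat 1 + outer_square v) ** transpose M = mat 1 + outer_square (M *v v)"
    by (simp add: matrix_add_ldistrib add_matrix_mul MM outer_square_conjugate)
  also have "\<dots> = (\<chi> i j. if i = j then (if i = k then 1 + v \<bullet> v else 1) else 0)"
    unfolding Mv by (auto simp: vec_eq_iff outer_square_def mat_def axis_def dot_square_norm power2_eq_square)
  also have "det \<dots> = (\<Prod>i\<in>UNIV. if i = k then 1 + v \<bullet> v else 1)"
    by (subst det_diagonal) auto
  also have "\<dots> = 1 + v \<bullet> v" by simp
  finally show ?thesis .
qed

text \<open>Along the $i$-th parameter line the chart is a constant plus the linear term in direction $i$ plus
  the height $s sqrt {C - t^2}$ in direction $k$, where $C$ collects the other coordinates.\<close>
lemma chart_tangent_hemisphere: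
  fixes k i :: "'n::finite"
  assumes y: "y \<in> hemisphere_domain k \<rho>" and i: "i \<noteq> k"
  shows "chart_tangent (hemisphere_chart k s \<rho>) i y =
    axis i 1 - (s * y i / sqrt (\<rho>\<^sup>2 - (\<Sum>j\<in>- {k}. (y j)\<^sup>2))) *\<^sub>R axis k 1"
proof -
  define C where "C = \<rho>\<^sup>2 - (\<Sum>j\<in>- {k} - {i}. (y j)\<^sup>2)"
  have sum: "(\<Sum>j\<in>- {k}. ((y(i := t)) j)\<^sup>2) = t\<^sup>2 + (\<Sum>j\<in>- {k} - {i}. (y j)\<^sup>2)" for t
    using i by (subst sum.remove[of _ i]) auto
  have C: "C - (y i)\<^sup>2 = \<rho>\<^sup>2 - (\<Sum>j\<in>- {k}. (y j)\<^sup>2)" using sum[of "y i"] by (simp add: C_def)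
  have pos: "C - (y i)\<^sup>2 > 0" using y unfolding C by (simp add: hemisphere_domain_def)
  have eq: "hemisphere_chart k s \<rho> (y(i := t)) =
      (\<chi> j. if j = k \<or> j = i then 0 else y j) + t *\<^sub>R axis i 1 + (s * sqrt (C - t\<^sup>2)) *\<^sub>R axis k 1" for t
    unfolding hemisphere_chart_def sum C_def using i
    by (auto simp: vec_eq_iff axis_def algebra_simps)
  have d: "((\<lambda>t. s * sqrt (C - t\<^sup>2)) has_real_derivative - (s * y i / sqrt (C - (y i)\<^sup>2))) (at (y i))"
    using pos by (auto intro!: derivative_eq_intros simp: field_simps)
  have "((\<lambda>t. hemisphere_chart k s \<rho> (y(i := t))) has_vector_derivative
     0 + 1 *\<^sub>R axis i 1 + (- (s * y i / sqrt (C - (y i)\<^sup>2))) *\<^sub>R axis k 1) (at (y i))"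
    unfolding eq
    by (intro has_vector_derivative_add has_vector_derivative_const
        bounded_linear.has_vector_derivative[OF bounded_linear_scaleR_left]
        d[unfolded has_real_derivative_iff_has_vector_derivative] has_vector_derivative_id)
  from vector_derivative_at[OF this] show ?thesis
    unfolding chart_tangent_def C by simp
qed

text \<open>In terms of $w = y / sqrt(\<rho>^2 - |y|^2)$ the tangent vectors have Gram matrix $1 + w w^T$, and
  $1 + |w|^2 = \<rho>^2 / (\<rho>^2 - |y|^2)$.  A conformal factor $c$ scales the $n-1$ tangential rows only;
  the row of $k$ is padding.\<close>
lemma det_induced_metric_hemisphere:
  fixes k :: "'n::finite"
  assumes y: "y \<in> hemisphere_domain k \<rho>" and s: "s\<^sup>2 = 1"
    and g: "g (hemisphere_chart k s \<rho> y) = c *\<^sub>R mat 1"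
  shows "det (induced_metric g (- {k}) (hemisphere_chart k s \<rho>) y) =
    c ^ (CARD('n) - 1) * (\<rho>\<^sup>2 / (\<rho>\<^sup>2 - (\<Sum>j\<in>- {k}. (y j)\<^sup>2)))"
proof -
  define R where "R = \<rho>\<^sup>2 - (\<Sum>j\<in>- {k}. (y j)\<^sup>2)"
  have R: "R > 0" using y by (simp add: R_def hemisphere_domain_def)
  define w :: "real^'n" where "w = (\<chi> i. if i = k then 0 else y i / sqrt R)"
  let ?T = "\<lambda>i. chart_tangent (hemisphere_chart k s \<rho>) i y"
  have T: "?T i \<bullet> (g (hemisphere_chart k s \<rho> y) *v ?T j) = c * ((if i = j then 1 else 0) + w $ i * w $ j)"
    if "i \<noteq> k" "j \<noteq> k" for i j
  proof -
    have "?T i \<bullet> (g (hemisphere_chart k s \<rho> y) *v ?T j) = c * (?T i \<bullet> ?T j)"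
      unfolding g by (simp flip: scaleR_matrix_vector_assoc)
    also have "?T i \<bullet> ?T j = (if i = j then 1 else 0) + s\<^sup>2 * (w $ i * w $ j)"
      unfolding chart_tangent_hemisphere[OF y that(1)] chart_tangent_hemisphere[OF y that(2)] R_def[symmetric]
      using that R by (auto simp: inner_diff_left inner_diff_right inner_axis_axis w_def power2_eq_square)
    finally show ?thesis using s by simp
  qed
  have "induced_metric g (- {k}) (hemisphere_chart k s \<rho>) y =
      (\<chi> i. (if i = k then 1 else c) *s ((mat 1 + outer_square w) $ i))"
    unfolding induced_metric_def using T
    by (auto simp: vec_eq_iff mat_def outer_square_def w_def distrib_left)
  then have "det (induced_metric g (- {k}) (hemisphere_chart k s \<rho>) y) =
      (\<Prod>i\<in>UNIV. if i = k then 1 else c) * det (mat 1 + outer_square w)"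
    by (simp only: det_rows_mul vec_lambda_eta)
  also have "(\<Prod>i\<in>UNIV. if i = k then 1 else c) = c ^ (CARD('n) - 1)"
    by (subst prod.remove[of _ k]) (auto simp: card_Diff_singleton)
  finally have det_eq: "det (induced_metric g (- {k}) (hemisphere_chart k s \<rho>) y) =
      c ^ (CARD('n) - 1) * det (mat 1 + outer_square w)" .
  have "w \<bullet> w = (\<Sum>j\<in>- {k}. (y j)\<^sup>2) / R"
  proof -
    have "w \<bullet> w = (\<Sum>i\<in>- {k}. w $ i * w $ i)"
      unfolding inner_vec_def inner_real_def by (rule sum.mono_neutral_right) (auto simp: w_def)
    also have "\<dots> = (\<Sum>j\<in>- {k}. (y j)\<^sup>2) / R"
      using R by (simp add: w_def sum_divide_distrib power2_eq_square)
    finally show ?thesis .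
  qed
  then have "det (mat 1 + outer_square w) = 1 + (\<Sum>j\<in>- {k}. (y j)\<^sup>2) / R"
    by (simp only: det_mat1_plus_outer_square)
  also have "\<dots> = \<rho>\<^sup>2 / R" using R by (simp add: field_simps) (simp add: R_def)
  finally have D: "det (mat 1 + outer_square w) = \<rho>\<^sup>2 / R" .
  show ?thesis unfolding det_eq D R_def ..
qed

text \<open>The distribution of $|y|^2$ under Lebesgue measure on $R^m$: the density is the derivative of
  $x -> \<omega>_m x^{m/2}$, the volume of the ball of squared radius $x$.\<close>
definition squared_radius_measure :: "nat \<Rightarrow> real measure" where
  "squared_radius_measure m = density lborel (\<lambda>x. ennreal (unit_ball_vol m * (m / 2) * x powr (m / 2 - 1)) * indicator {0..} x)"

lemma emeasure_squared_radius_measure: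
  assumes "m > 0" "x \<ge> 0"
  shows "emeasure (squared_radius_measure m) {..x} = ennreal (unit_ball_vol m * x powr (m / 2))"
proof -
  let ?c = "unit_ball_vol m * (m / 2)"
  have "emeasure (squared_radius_measure m) {..x} =
      (\<integral>\<^sup>+t. ennreal (?c * t powr (m / 2 - 1)) * indicator {0..x} t \<partial>lborel)"
    unfolding squared_radius_measure_def
    by (subst emeasure_density) (auto intro!: nn_integral_cong simp: indicator_def)
  also have "\<dots> = ennreal (?c * (x powr (m / 2 - 1 + 1) / (m / 2 - 1 + 1)))"
    by (intro nn_integral_has_integral_lebesgue' has_integral_mult_right has_integral_powr_from_0)
       (use assms in auto)
  finally show ?thesis using assms by simp
qed

text \<open>Polar coordinates for radial functions: both measures give the volume of a ball to every
  half line \<open>{..a}\<close>, and these half lines generate the Borel sets.  Using $|y|^2$ rather than $|y|$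
  as the radial variable turns the integral over the hemisphere into a Beta integral without a
  nonlinear substitution.\<close>
lemma distr_sum_squares_PiM:
  fixes A :: "'i set"
  assumes A: "finite A" "A \<noteq> {}"
  shows "distr (Pi\<^sub>M A (\<lambda>_. lborel)) borel (\<lambda>y. \<Sum>i\<in>A. (y i)\<^sup>2) = squared_radius_measure (card A)"
    (is "?L = ?R")
proof (rule measure_eqI_generator_eq[where E="range (\<lambda>a. {..a::real})" and \<Omega>=UNIV and A="\<lambda>i. {..real i}"])
  interpret product_sigma_finite "\<lambda>_::'i. lborel :: real measure" by standard
  let ?P = "Pi\<^sub>M A (\<lambda>_. lborel :: real measure)"
  have m: "card A > 0" using A by (simp add: card_gt_0_iff)
  have eq: "emeasure ?L {..a} = emeasure ?R {..a}" for a
  proof -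
    have L: "emeasure ?L {..a} = emeasure ?P ({y. (\<Sum>i\<in>A. (y i)\<^sup>2) \<le> a} \<inter> space ?P)"
      by (subst emeasure_distr) (auto intro!: arg_cong[where f="emeasure ?P"])
    consider "a < 0" | "a = 0" | "a > 0" by linarith
    then show ?thesis
    proof cases
      case 1
      have "(\<Sum>i\<in>A. (y i)\<^sup>2) \<ge> 0" for y :: "'i \<Rightarrow> real" by (simp add: sum_nonneg)
      then have "{y. (\<Sum>i\<in>A. (y i)\<^sup>2) \<le> a} = {}" using 1 by (auto simp: not_le intro: less_le_trans)
      moreover have "emeasure ?R {..a} = (\<integral>\<^sup>+t. 0 \<partial>(lborel :: real measure))"
        unfolding squared_radius_measure_def
        by (subst emeasure_density, simp, simp, rule nn_integral_cong) (use 1 in \<open>auto simp: indicator_def\<close>)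
      ultimately show ?thesis unfolding L by simp
    next
      case 2
      have "{y. (\<Sum>i\<in>A. (y i)\<^sup>2) \<le> a} \<inter> space ?P = (\<Pi>\<^sub>E i\<in>A. {0})"
      proof -
        have "(\<Sum>i\<in>A. (y i)\<^sup>2) \<le> 0 \<longleftrightarrow> (\<forall>i\<in>A. y i = 0)" for y :: "'i \<Rightarrow> real"
          using sum_nonneg_eq_0_iff[OF A(1), of "\<lambda>i. (y i)\<^sup>2"] sum_nonneg[of A "\<lambda>i. (y i)\<^sup>2"] by auto
        then show ?thesis by (auto simp: 2 space_PiM PiE_iff extensional_def restrict_def fun_eq_iff)
      qed
      moreover have "emeasure ?P (\<Pi>\<^sub>E i\<in>A. {0}) = (\<Prod>i\<in>A. emeasure lborel {0::real})"
        by (rule emeasure_PiM) (use A in auto)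
      ultimately have "emeasure ?L {..a} = (\<Prod>i\<in>A. emeasure lborel {0::real})"
        unfolding L by (simp only:)
      then show ?thesis using A 2 m by (simp add: emeasure_squared_radius_measure)
    next
      case 3
      have "{y. (\<Sum>i\<in>A. (y i)\<^sup>2) \<le> a} = {y. sqrt (\<Sum>i\<in>A. (y i)\<^sup>2) \<le> sqrt a}" by simp
      then have "emeasure ?L {..a} = ennreal (unit_ball_vol (real (card A)) * sqrt a ^ card A)"
        unfolding L using emeasure_cball_aux[OF A(1), of "sqrt a"] 3 by simp
      also have "sqrt a ^ card A = a powr (card A / 2)"
        using 3 by (simp add: powr_half_sqrt[symmetric] powr_powr flip: powr_realpow)
      finally show ?thesis using 3 m by (simp add: emeasure_squared_radius_measure)
    qed
  qed
  then show "emeasure ?L X = emeasure ?R X" if "X \<in> range (\<lambda>a. {..a})" for X using that by auto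
  show "emeasure ?L {..real i} \<noteq> \<infinity>" for i
    unfolding eq using m by (simp add: emeasure_squared_radius_measure)
  show "(\<Union>i. {..real i}) = UNIV" by (auto intro: real_arch_simple)
  have "sets borel = sigma_sets UNIV (range (\<lambda>a::real. {..a}))"
    by (subst borel_eq_atMost) simp
  then show "sets ?L = sigma_sets UNIV (range (\<lambda>a::real. {..a}))"
     "sets ?R = sigma_sets UNIV (range (\<lambda>a::real. {..a}))"
    by (simp_all add: squared_radius_measure_def)
qed (auto simp: Int_stable_def)

text \<open>The integrand is the Euclidean area density of the graph of $sqrt(\<rho>^2 - |y|^2)$.  After
  scaling to radius 1 the radial integral is $B(m/2, 1/2)$, which the Gamma function turns into
  half the area of the unit sphere in dimension $m + 1$.\<close>
lemma nn_integral_hemisphere: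
  fixes A :: "'i set"
  assumes A: "finite A" "A \<noteq> {}" and \<rho>: "\<rho> > 0"
  defines "m \<equiv> card A"
  shows "(\<integral>\<^sup>+y. ennreal (indicator {..<\<rho>\<^sup>2} (\<Sum>i\<in>A. (y i)\<^sup>2) * (\<rho> / sqrt (\<rho>\<^sup>2 - (\<Sum>i\<in>A. (y i)\<^sup>2)))) \<partial>(Pi\<^sub>M A (\<lambda>_. lborel)))
    = ennreal ((real m + 1) / 2 * unit_ball_vol (real m + 1) * \<rho> ^ m)"
proof -
  have m: "m > 0" unfolding m_def using A by (simp add: card_gt_0_iff)
  let ?c = "unit_ball_vol m * (m / 2)"
  let ?f = "\<lambda>x. indicator {..<\<rho>\<^sup>2} x * (\<rho> / sqrt (\<rho>\<^sup>2 - x))"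
  have "(\<integral>\<^sup>+y. ennreal (?f (\<Sum>i\<in>A. (y i)\<^sup>2)) \<partial>(Pi\<^sub>M A (\<lambda>_. lborel))) =
      (\<integral>\<^sup>+x. ennreal (?f x) \<partial>squared_radius_measure m)"
    unfolding m_def distr_sum_squares_PiM[OF A, symmetric] by (subst nn_integral_distr) auto
  also have "\<dots> = (\<integral>\<^sup>+x. ennreal (?c * x powr (m / 2 - 1)) * indicator {0..} x * ennreal (?f x) \<partial>lborel)"
    unfolding squared_radius_measure_def by (subst nn_integral_density) auto
  \<comment> \<open>Substitute $x = \<rho>^2 t$.\<close>
  also have "\<dots> = ennreal (\<rho>\<^sup>2) * (\<integral>\<^sup>+t. ennreal (?c * (\<rho>\<^sup>2 * t) powr (m / 2 - 1)) * indicator {0..} (\<rho>\<^sup>2 * t) * ennreal (?f (\<rho>\<^sup>2 * t)) \<partial>lborel)"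
    using \<rho> by (subst nn_integral_real_affine[where c="\<rho>\<^sup>2" and t=0]) auto
  also have "(\<integral>\<^sup>+t. ennreal (?c * (\<rho>\<^sup>2 * t) powr (m / 2 - 1)) * indicator {0..} (\<rho>\<^sup>2 * t) * ennreal (?f (\<rho>\<^sup>2 * t)) \<partial>lborel)
      = (\<integral>\<^sup>+t. ennreal (?c * \<rho> powr (real m - 2) * (t powr (m / 2 - 1) * (1 - t) powr (1 / 2 - 1))) * indicator {0..1} t \<partial>lborel)"
  proof (rule nn_integral_cong)
    fix t :: real
    have "ennreal (?c * (\<rho>\<^sup>2 * t) powr (m / 2 - 1)) * ennreal (?f (\<rho>\<^sup>2 * t)) =
       ennreal (?c * \<rho> powr (real m - 2) * (t powr (m / 2 - 1) * (1 - t) powr (1 / 2 - 1)))" if t: "0 \<le> t" "t < 1"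
    proof -
      have "(\<rho>\<^sup>2 * t) powr (m / 2 - 1) = \<rho> powr (real m - 2) * t powr (m / 2 - 1)"
        using \<rho> t by (simp add: powr_mult powr_powr algebra_simps flip: powr_numeral)
      moreover have "?f (\<rho>\<^sup>2 * t) = (1 - t) powr (1 / 2 - 1)"
      proof -
        have "\<rho>\<^sup>2 - \<rho>\<^sup>2 * t = \<rho>\<^sup>2 * (1 - t)" by (simp add: algebra_simps)
        then have "sqrt (\<rho>\<^sup>2 - \<rho>\<^sup>2 * t) = \<rho> * sqrt (1 - t)" using \<rho> by (simp add: real_sqrt_mult)
        moreover have "(1 - t) powr (1 / 2 - 1) = 1 / sqrt (1 - t)"
          using t by (simp add: powr_minus_divide powr_half_sqrt)
        ultimately show ?thesis using \<rho> t by (simp add: indicator_def)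
      qed
      ultimately show ?thesis using t by (subst ennreal_mult[symmetric]) (auto simp: mult_ac)
    qed
    moreover have "\<rho>\<^sup>2 * t < \<rho>\<^sup>2 \<longleftrightarrow> t < 1" using \<rho> by simp
    ultimately show "ennreal (?c * (\<rho>\<^sup>2 * t) powr (m / 2 - 1)) * indicator {0..} (\<rho>\<^sup>2 * t) * ennreal (?f (\<rho>\<^sup>2 * t))
      = ennreal (?c * \<rho> powr (real m - 2) * (t powr (m / 2 - 1) * (1 - t) powr (1 / 2 - 1))) * indicator {0..1} t"
      using \<rho> by (cases "0 \<le> t"; cases "t < 1") (auto simp: indicator_def zero_le_mult_iff)
  qed
  also have "\<dots> = ennreal (?c * \<rho> powr (real m - 2) * Beta (m / 2) (1 / 2))"
    by (intro nn_integral_has_integral_lebesgue' has_integral_mult_right has_integral_Beta_real)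
       (use m in auto)
  also have "ennreal (\<rho>\<^sup>2) * \<dots> = ennreal (?c * Beta (m / 2) (1 / 2) * (\<rho>\<^sup>2 * \<rho> powr (real m - 2)))"
    by (subst ennreal_mult'[symmetric]) (auto simp: mult_ac)
  also have "\<rho>\<^sup>2 * \<rho> powr (real m - 2) = \<rho> ^ m"
    using \<rho> by (simp add: powr_diff powr_realpow)
  also have "?c * Beta (m / 2) (1 / 2) = (real m + 1) / 2 * unit_ball_vol (real m + 1)"
  proof -
    have G: "Gamma (real m / 2 + 1) = m / 2 * Gamma (m / 2)"
       "Gamma ((real m + 1) / 2 + 1) = (real m + 1) / 2 * Gamma ((real m + 1) / 2)"
      using m by (intro Gamma_plus1; auto)+
    define a b where "a = Gamma (real m / 2)" and "b = Gamma ((real m + 1) / 2)"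
    have "a > 0" "b > 0" "real m / 2 + 1 / 2 = (real m + 1) / 2" using m by (simp_all add: a_def b_def)
    then show ?thesis
      unfolding unit_ball_vol_def Beta_def G using m
      by (simp add: Gamma_one_half_real add_divide_distrib powr_add powr_half_sqrt flip: a_def b_def)
  qed
  finally show ?thesis .
qed

text \<open>A conformal factor that is constant on the sphere leaves the area density of each hemisphere
  Euclidean up to a constant factor, so the two hemispheres contribute equally.\<close>
lemma sphere_area_conformally_flat:
  fixes g :: "real^'n::finite \<Rightarrow> real^'n^'n"
  assumes n: "CARD('n) \<ge> 2" and \<rho>: "\<rho> > 0" and c: "c \<ge> 0"
    and g: "\<And>x. norm x = \<rho> \<Longrightarrow> g x = c *\<^sub>R mat 1"
  shows "sphere_area g \<rho> = sqrt (c ^ (CARD('n) - 1)) * (CARD('n) * unit_ball_vol CARD('n) * \<rho> ^ (CARD('n) - 1))"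
proof -
  define m where "m = CARD('n) - 1"
  define k where "k = (SOME k::'n. True)"
  let ?A = "- {k}" and ?P = "Pi\<^sub>M (- {k}) (\<lambda>_. lborel :: real measure)"
  let ?h = "\<lambda>y. indicator {..<\<rho>\<^sup>2} (\<Sum>i\<in>?A. (y i)\<^sup>2) * (\<rho> / sqrt (\<rho>\<^sup>2 - (\<Sum>i\<in>?A. (y i)\<^sup>2)))"
  have card: "card ?A = m" by (simp add: m_def Compl_eq_Diff_UNIV card_Diff_singleton)
  have m: "m > 0" using n by (simp add: m_def)
  then have A: "finite ?A" "?A \<noteq> {}" using card by (auto simp: card_gt_0_iff)
  have nm: "real m + 1 = CARD('n)" using n by (simp add: m_def)
  have "(\<integral>y. ?h y \<partial>?P) = CARD('n) / 2 * unit_ball_vol CARD('n) * \<rho> ^ m"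
  proof (rule has_bochner_integral_integral_eq, rule has_bochner_integral_nn_integral)
    show "(\<integral>\<^sup>+y. ennreal (?h y) \<partial>?P) = ennreal (CARD('n) / 2 * unit_ball_vol CARD('n) * \<rho> ^ m)"
      using nn_integral_hemisphere[OF A \<rho>] unfolding card nm .
    show "AE y in ?P. 0 \<le> ?h y" using \<rho> by (auto intro!: AE_I2 simp: indicator_def)
  qed (use \<rho> in auto)
  moreover have "chart_area g ?A (hemisphere_chart k s \<rho>) (hemisphere_domain k \<rho>) = sqrt (c ^ m) * (\<integral>y. ?h y \<partial>?P)"
    if s: "s\<^sup>2 = 1" for s
  proof -
    have "indicator (hemisphere_domain k \<rho>) y *\<^sub>R sqrt (det (induced_metric g ?A (hemisphere_chart k s \<rho>) y)) =
        sqrt (c ^ m) * ?h y" if y: "y \<in> space ?P" for y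
    proof (cases "y \<in> hemisphere_domain k \<rho>")
      case True
      then have less: "(\<Sum>i\<in>?A. (y i)\<^sup>2) < \<rho>\<^sup>2" by (simp add: hemisphere_domain_def)
      have "(norm (hemisphere_chart k s \<rho> y))\<^sup>2 = \<rho>\<^sup>2"
      proof -
        have "(norm (hemisphere_chart k s \<rho> y))\<^sup>2 = (\<Sum>i\<in>UNIV. (hemisphere_chart k s \<rho> y $ i)\<^sup>2)"
          unfolding power2_norm_eq_inner inner_vec_def by (simp add: power2_eq_square)
        also have "\<dots> = (hemisphere_chart k s \<rho> y $ k)\<^sup>2 + (\<Sum>i\<in>?A. (hemisphere_chart k s \<rho> y $ i)\<^sup>2)"
          by (subst sum.remove[of _ k]) (auto simp: Compl_eq_Diff_UNIV)
        also have "(\<Sum>i\<in>?A. (hemisphere_chart k s \<rho> y $ i)\<^sup>2) = (\<Sum>i\<in>?A. (y i)\<^sup>2)"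
          by (intro sum.cong) (auto simp: hemisphere_chart_def)
        finally show ?thesis using less s by (simp add: hemisphere_chart_def power_mult_distrib)
      qed
      then have "norm (hemisphere_chart k s \<rho> y) = \<rho>" using \<rho> by (simp add: power2_eq_iff_nonneg)
      from det_induced_metric_hemisphere[where g=g, OF True s g[OF this]] show ?thesis
        using True less \<rho> by (simp add: real_sqrt_mult real_sqrt_divide m_def)
    next
      case False
      then have "\<not> (\<Sum>i\<in>?A. (y i)\<^sup>2) < \<rho>\<^sup>2" using y by (auto simp: hemisphere_domain_def space_PiM)
      then show ?thesis using False by simp
    qed
    then have "chart_area g ?A (hemisphere_chart k s \<rho>) (hemisphere_domain k \<rho>) = (\<integral>y. sqrt (c ^ m) * ?h y \<partial>?P)"
      unfolding chart_area_def set_lebesgue_integral_def by (intro Bochner_Integration.integral_cong refl) auto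
    then show ?thesis by (simp only: Bochner_Integration.integral_mult_right_zero)
  qed
  ultimately have "sphere_area g \<rho> = (\<Sum>s\<in>{1, -1::real}. sqrt (c ^ m) * (CARD('n) / 2 * unit_ball_vol CARD('n) * \<rho> ^ m))"
    unfolding sphere_area_def Let_def k_def[symmetric] by (intro sum.cong refl) auto
  then show ?thesis by (simp add: m_def)
qed

lemma sphere_area_flat_metric:
  assumes "CARD('n::finite) \<ge> 2"
  shows "sphere_area (flat_metric :: real^'n \<Rightarrow> real^'n^'n) 1 = CARD('n) * unit_ball_vol CARD('n)"
  by (subst sphere_area_conformally_flat[where c=1]) (use assms in \<open>auto simp: flat_metric_def\<close>)

section \<open>Volume of annuli\<close>

lemma annulus_eq:
  assumes "r > 0"
  shows "annulus r = ball (0::real^'n::finite) 1 - cball 0 r"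
  using assms by (simp add: annulus_def)

lemma closure_annulus_subset:
  assumes "r > 0"
  shows "closure (annulus r) \<subseteq> cball (0::real^'n::finite) 1 - ball 0 r"
  unfolding annulus_eq[OF assms]
  by (rule closure_minimal) (auto intro: closed_Diff)

lemma metric_volume_conformally_flat:
  fixes \<phi> :: "real^'n::finite \<Rightarrow> real"
  shows "metric_volume (\<lambda>x. \<phi> x *\<^sub>R flat_metric x) S = (LINT x:S|lborel. sqrt (\<phi> x ^ CARD('n)))"
proof -
  have "det (c *\<^sub>R (mat 1 :: real^'n^'n)) = c ^ CARD('n)" for c
    by (subst det_diagonal) (auto simp: mat_def)
  then show ?thesis by (simp add: metric_volume_def flat_metric_def)
qed

text \<open>With $c = n - 2$, the exponents $k = n$ and $k = n - 1$ give the volume density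
  $u^{2n/(n-2)}$ and the area density $u^{2(n-1)/(n-2)}$ of the metric with factor $u^{4/(n-2)}$.\<close>
lemma sqrt_conformal_power:
  fixes a c :: real
  assumes "a > 0"
  shows "sqrt ((a powr (4 / c)) ^ k) = a powr (2 * k / c)"
proof -
  have "(a powr (4 / c)) ^ k = a powr (4 * k / c)"
    using assms by (simp add: powr_powr flip: powr_realpow)
  also have "4 * k / c = 2 * k / c + 2 * k / c"
    by (simp flip: add_divide_distrib)
  finally show ?thesis by (simp only: powr_add) simp
qed

text \<open>Since $u \<ge> 1$ and the exponent $2N/(N-2)$ of the volume density is at least 1, the density is at
  least $u$.  The right-hand side integrates the lower bound for $u$: the ball of radius $1/2$ lies
  well inside the annulus, so a fixed proportion of the volume profits from $b$.\<close>
lemma metric_volume_lower_bound: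
  fixes u :: "real^'n::finite \<Rightarrow> real"
  assumes n: "CARD('n) \<ge> 3" and r: "0 < r" "r \<le> 1/2" and b: "0 \<le> b"
    and cont: "continuous_on (- {0}) u"
    and lower: "\<And>x. x \<noteq> 0 \<Longrightarrow> norm x \<le> 1 \<Longrightarrow> u x \<ge> 1 + b * indicator (cball 0 (1/2)) x"
  defines "N \<equiv> CARD('n)"
  shows "metric_volume (\<lambda>x. u x powr (4 / (real N - 2)) *\<^sub>R flat_metric x) (annulus r) \<ge>
     unit_ball_vol N * (1 - r ^ N + b * ((1/2) ^ N - r ^ N))"
proof -
  let ?S = "annulus r :: (real^'n) set" and ?K = "cball 0 (1/2) :: (real^'n) set"
  let ?C = "cball 0 1 - ball 0 r :: (real^'n) set"
  let ?F = "\<lambda>x. sqrt ((u x powr (4 / (real N - 2))) ^ N)"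
  have S: "x \<noteq> 0" "norm x \<le> 1" if "x \<in> ?C" for x using that r by auto
  have SC: "?S \<subseteq> ?C" unfolding annulus_eq[OF r(1)] by auto
  have u1: "u x \<ge> 1" if "x \<in> ?C" for x
  proof -
    have "b * indicator ?K x \<ge> 0" using b by simp
    then show ?thesis using lower[OF S[OF that]] by linarith
  qed
  have Fge: "?F x \<ge> 1 + b * indicator ?K x" if x: "x \<in> ?S" for x
  proof -
    have x': "x \<in> ?C" using x SC by blast
    note u1 = u1[OF x']
    have "?F x = u x powr (2 * real N / (real N - 2))"
      using u1 by (intro sqrt_conformal_power) simp
    moreover have "u x powr 1 \<le> u x powr (2 * real N / (real N - 2))"
      using n u1 by (intro powr_mono) (auto simp: N_def field_simps)
    ultimately show ?thesis using lower[OF S[OF x']] u1 by simp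
  qed
  have [measurable]: "?S \<in> sets lborel" unfolding annulus_eq[OF r(1)] by auto
  have cF: "continuous_on ?C ?F"
    by (intro continuous_intros continuous_on_subset[OF cont]) (use S u1 in force)+
  have "set_integrable lborel ?C ?F"
    unfolding set_integrable_def
    by (rule borel_integrable_compact[OF _ cF]) (intro compact_diff, auto)
  then have iF: "set_integrable lborel ?S ?F"
    by (rule set_integrable_subset) (use SC in \<open>auto simp: annulus_eq[OF r(1)]\<close>)
  have top: "emeasure lborel (ball (0::real^'n) 1) \<noteq> \<infinity>" "emeasure lborel ?K \<noteq> \<infinity>"
    using emeasure_lborel_ball_finite[of "0::real^'n" 1] emeasure_lborel_cball_finite[of "0::real^'n" "1/2"]
    by auto
  let ?f = "\<lambda>x. indicator ?S x + b * indicator (?K - cball 0 r) x :: real"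
  have fin: "emeasure lborel ?S < \<infinity>" "emeasure lborel (?K - cball 0 r) < \<infinity>"
  proof -
    show "emeasure lborel ?S < \<infinity>"
      by (rule emeasure_bounded_finite, rule bounded_subset[OF bounded_cball[of 0 1]]) (use SC in auto)
    show "emeasure lborel (?K - cball 0 r) < \<infinity>"
      by (rule emeasure_bounded_finite, rule bounded_subset[OF bounded_cball[of 0 "1/2"]]) auto
  qed
  have iF': "integrable lborel ?f"
    using fin by (intro Bochner_Integration.integrable_add integrable_mult_right integrable_real_indicator) (auto simp: annulus_eq[OF r(1)])
  have "integral\<^sup>L lborel ?f \<le> (LINT x:?S|lborel. ?F x)"
    unfolding set_lebesgue_integral_def
  proof (rule integral_mono[OF iF' iF[unfolded set_integrable_def]])
    fix x :: "real^'n"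
    have "x \<in> ?S" if "x \<in> ?K - cball 0 r" using that r by (auto simp: annulus_eq)
    then show "?f x \<le> indicator ?S x *\<^sub>R ?F x"
      using Fge[of x] by (auto simp: indicator_def annulus_eq[OF r(1)] split: if_splits)
  qed
  also have "integral\<^sup>L lborel ?f = measure lborel ?S + b * measure lborel (?K - cball 0 r)"
    using fin by (subst Bochner_Integration.integral_add) (auto simp: annulus_eq[OF r(1)])
  also have "measure lborel ?S = unit_ball_vol N * (1 - r ^ N)"
    unfolding annulus_eq[OF r(1)] using r top
    by (subst measure_Diff) (auto simp: content_ball content_cball N_def algebra_simps)
  also have "measure lborel (?K - cball 0 r) = unit_ball_vol N * ((1/2) ^ N - r ^ N)"
    using r top
    by (subst measure_Diff) (auto simp: content_ball content_cball N_def algebra_simps)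
  finally show ?thesis unfolding metric_volume_conformally_flat N_def[symmetric] by (simp add: algebra_simps)
qed

section \<open>Comparison of the annulus with the ball\<close>

text \<open>By convexity the graph of $(1+x)^N$ lies below its chord over $[0,1]$.\<close>
lemma one_plus_power_le:
  fixes x :: real
  assumes "0 \<le> x" "x \<le> 1"
  shows "(1 + x) ^ N \<le> 1 + (2 ^ N - 1) * x"
proof (induction N)
  case (Suc N)
  have "(1 + x) ^ Suc N \<le> (1 + (2 ^ N - 1) * x) * (1 + x)"
    using Suc assms by (simp add: mult.commute mult_right_mono)
  also have "\<dots> = 1 + 2 ^ N * x + (2 ^ N - 1) * (x * x)" by (simp add: algebra_simps)
  also have "\<dots> \<le> 1 + 2 ^ N * x + (2 ^ N - 1) * (x * 1)"
    using assms by (intro add_left_mono mult_left_mono) (auto intro: mult_left_le)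
  finally show ?case by (simp add: algebra_simps)
qed simp

text \<open>The gain of volume on the right is of order $r^{N-2}$, the growth of the boundary area on the left
  of order $r^{N-1}$, so the inequality must hold for small $r$.  After linearizing the left side
  and dividing by $r^{N-2}$ it reads $2^N 16 r < 2^{-N} - r^N - r^2$; the bound on $r$ makes each
  of the three terms in $r$ at most a quarter of $2^{-N}$.\<close>
lemma isoperimetric_comparison:
  fixes N :: nat and r :: real
  assumes N: "N \<ge> 3" and r: "0 < r" "r < (1/2) ^ (2 * N + 6)"
  shows "(1 + 16 * r ^ (N - 1)) ^ N < 1 - r ^ N + r ^ (N - 2) * ((1/2) ^ N - r ^ N)"
proof -
  define H T :: real where "H = (1/2) ^ N" and "T = 2 ^ N"
  have H: "0 < H" "H \<le> 1" "T * H = 1" "T \<ge> 1"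
    by (simp_all add: H_def T_def power_le_one power_one_over)
  have e: "(1/2::real) ^ (2 * N + 6) = H * H / 64"
  proof -
    have "(1/2::real) ^ (2 * N + 6) = H\<^sup>2 * (1/2) ^ 6"
      unfolding H_def by (simp only: power_add power_mult mult.commute[of 2 N])
    also have "(1/2::real) ^ 6 = 1 / 64" by (simp add: power_one_over)
    finally show ?thesis by (simp add: power2_eq_square)
  qed
  have "H * H \<le> H" using H by (simp add: mult_left_le)
  then have t: "r < H / 64" using r(2) unfolding e by linarith
  then have r1: "r \<le> 1" using H by linarith
  have t2: "T * 16 * r < H / 4"
  proof -
    have "T * 16 * r < T * 16 * (H * H / 64)"
      using r(2) H unfolding e by (intro mult_strict_left_mono) auto
    also have "\<dots> = (T * H) * H / 4" by simp
    finally show ?thesis unfolding H(3) by simp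
  qed
  have rk: "r ^ j \<le> r" if "j \<ge> 1" for j
    using power_decreasing[of 1 j r] r r1 that by simp
  obtain k where k: "N = k + 2" using N le_Suc_ex[of 2 N] by (auto simp: add.commute)
  have p: "N - 1 = k + 1" "N - 2 = k" using k by simp_all
  have x1: "16 * r ^ (N - 1) \<le> 1" using rk[of "N - 1"] N t H by linarith
  have "(1 + 16 * r ^ (N - 1)) ^ N \<le> 1 + (T - 1) * (16 * r ^ (N - 1))"
    unfolding T_def using r x1 by (intro one_plus_power_le) auto
  also have "\<dots> \<le> 1 + T * (16 * r ^ (N - 1))"
    using r by (intro add_left_mono mult_right_mono) auto
  also have "\<dots> = 1 + r ^ k * (T * 16 * r)" unfolding p by simp
  also have "\<dots> < 1 + r ^ k * (H - r ^ N - r\<^sup>2)"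
  proof -
    have "T * 16 * r < H - r ^ N - r\<^sup>2" using t t2 rk[of N] rk[of 2] N H by linarith
    then show ?thesis using r by (intro add_strict_left_mono mult_strict_left_mono) auto
  qed
  also have "\<dots> = 1 - r ^ (k + 2) + r ^ k * (H - r ^ N)"
    by (simp add: algebra_simps power_add power2_eq_square)
  finally show ?thesis unfolding H_def p(2) k[symmetric] .
qed

theorem theorem1p4:
  assumes "CARD('n::finite) \<ge> 3"
  defines "n \<equiv> real CARD('n)"
  defines "\<omega> \<equiv> measure lborel (ball (0::real^'n) 1)"
  shows "(\<exists>r0::real. 0 < r0 \<and> r0 < 1 \<and> (\<forall>r. 0 < r \<and> r < r0 \<longrightarrow>
      (\<exists>g :: real^'n \<Rightarrow> real^'n^'n.
         riemannian_metric_on (closure (annulus r)) g \<and>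
         conformally_equivalent_on (closure (annulus r)) g flat_metric \<and>
         (\<forall>x\<in>annulus r. scalar_curvature g x = 0) \<and>
         metric_volume g (annulus r) powr (1 / n) / annulus_boundary_area g r powr (1 / (n - 1))
           > \<omega> powr (1 / n) / sphere_area (flat_metric :: real^'n \<Rightarrow> real^'n^'n) 1 powr (1 / (n - 1))))) \<and>
    \<omega> powr (1 / n) / sphere_area (flat_metric :: real^'n \<Rightarrow> real^'n^'n) 1 powr (1 / (n - 1))
      = n powr (- 1 / (n - 1)) * \<omega> powr (- 1 / (n * (n - 1)))"
proof (rule conjI)
  define N where "N = CARD('n)"
  have N: "N \<ge> 3" and n: "n = real N" "n \<ge> 3" using assms by (simp_all add: N_def n_def)
  have \<omega>: "\<omega> = unit_ball_vol N" "\<omega> > 0" by (simp_all add: \<omega>_def N_def content_ball)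
  have flat: "sphere_area (flat_metric :: real^'n \<Rightarrow> real^'n^'n) 1 = n * \<omega>"
    using sphere_area_flat_metric[where 'n='n] assms(1) by (simp add: n \<omega> N_def)
  show "\<omega> powr (1 / n) / sphere_area (flat_metric :: real^'n \<Rightarrow> real^'n^'n) 1 powr (1 / (n - 1))
      = n powr (- 1 / (n - 1)) * \<omega> powr (- 1 / (n * (n - 1)))"
  proof -
    have "- 1 / (n * (n - 1)) + n / (n * (n - 1)) = (- 1 + n) / (n * (n - 1))"
      by (rule add_divide_distrib[symmetric])
    moreover have "n / (n * (n - 1)) = 1 / (n - 1)" "(- 1 + n) / (n * (n - 1)) = 1 / n"
      using n(2) by simp_all
    ultimately have e: "1 / n = - 1 / (n * (n - 1)) + 1 / (n - 1)" by (simp only:)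
    have "\<omega> powr (1 / n) = \<omega> powr (- 1 / (n * (n - 1))) * \<omega> powr (1 / (n - 1))"
      unfolding e by (rule powr_add)
    moreover have "n powr (- 1 / (n - 1)) = 1 / n powr (1 / (n - 1))"
      using powr_minus_divide[of n "1 / (n - 1)"] by simp
    ultimately show ?thesis unfolding flat using n \<omega> by (simp add: powr_mult)
  qed
  show "\<exists>r0::real. 0 < r0 \<and> r0 < 1 \<and> (\<forall>r. 0 < r \<and> r < r0 \<longrightarrow>
      (\<exists>g :: real^'n \<Rightarrow> real^'n^'n.
         riemannian_metric_on (closure (annulus r)) g \<and>
         conformally_equivalent_on (closure (annulus r)) g flat_metric \<and>
         (\<forall>x\<in>annulus r. scalar_curvature g x = 0) \<and>
         metric_volume g (annulus r) powr (1 / n) / annulus_boundary_area g r powr (1 / (n - 1))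
           > \<omega> powr (1 / n) / sphere_area (flat_metric :: real^'n \<Rightarrow> real^'n^'n) 1 powr (1 / (n - 1))))"
  proof (intro exI[of _ "(1/2) ^ (2 * N + 6)"] conjI allI impI)
    show "(0::real) < (1/2) ^ (2 * N + 6)" by simp
    show "(1/2::real) ^ (2 * N + 6) < 1" 
    proof -
      have "(1/2::real) ^ (2 * N + 6) \<le> (1/2) ^ 1" by (intro power_decreasing) auto
      also have "\<dots> < 1" by simp
      finally show ?thesis .
    qed
    fix r :: real assume r: "0 < r \<and> r < (1/2) ^ (2 * N + 6)"
    have r_half: "r < 1/2"
    proof -
      have "(1/2::real) ^ (2 * N + 6) \<le> (1/2) ^ 1" by (intro power_decreasing) auto
      then show ?thesis using r by simp
    qed
    \<comment> \<open>This size of $b$ makes $b |x|^{2-n} = 1$ on the inner sphere: the factor stays bounded by 2 there.\<close>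
    define b where "b = r ^ (N - 2)"
    have b: "0 < b" "b < 1" using r r_half N by (auto simp: b_def intro!: power_less_one_iff[THEN iffD2])
    define u :: "real^'n \<Rightarrow> real" where "u = green_factor b"
    define \<phi> where "\<phi> = (\<lambda>x. u x powr (4 / (n - 2)))"
    let ?g = "\<lambda>x. \<phi> x *\<^sub>R (flat_metric x :: real^'n^'n)"
    let ?U = "- {0::real^'n}"
    have U: "open ?U" "closure (annulus r) \<subseteq> ?U"
      using closure_annulus_subset[of r] r by (auto intro: open_Compl)
    have upos: "u x > 0" for x unfolding u_def using b by (intro green_factor_pos) auto
    have uC: "C_diff k ?U u" for k unfolding u_def by (rule C_diff_green_factor)
    have \<phi>: "smooth_on (closure (annulus r)) \<phi>" "\<phi> x > 0" for x
      unfolding \<phi>_def using uC U upos by (auto intro!: smooth_on_powr simp: less_imp_neq[symmetric])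

    have metric: "riemannian_metric_on (closure (annulus r)) ?g"
      using \<phi> by (intro riemannian_metric_on_conformally_flat)
    have conf: "conformally_equivalent_on (closure (annulus r)) ?g flat_metric"
      unfolding conformally_equivalent_on_def using \<phi> by blast
    have scal: "scalar_curvature ?g x = 0" if "x \<in> annulus r" for x
    proof -
      have x: "x \<in> ?U" using that U(2) closure_subset by blast
      show ?thesis
        unfolding \<phi>_def n_def
        by (subst scalar_curvature_conformal_power[OF assms(1) U(1) x])
           (use upos uC x laplacian_green_factor[of x b] in \<open>auto simp: u_def\<close>)
    qed

    \<comment> \<open>Volume and boundary area relative to the values $\<omega>$ and $n \<omega>$ of the flat unit ball.\<close>
    define v where "v = 1 - r ^ N + b * ((1/2) ^ N - r ^ N)"
    define \<sigma> where "\<sigma> = 1 + (2 - b) powr (2 * (n - 1) / (n - 2)) * r ^ (N - 1)"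
    have vol: "metric_volume ?g (annulus r) \<ge> \<omega> * v"
      unfolding \<phi>_def n(1) N_def \<omega>(1) v_def
    proof (rule metric_volume_lower_bound)
      show "continuous_on ?U u" using uC[of 0] by simp
      show "u x \<ge> 1 + b * indicator (cball 0 (1/2)) x" if "x \<noteq> 0" "norm x \<le> 1" for x
        unfolding u_def using that b assms(1) by (intro green_factor_lower_bound) auto
    qed (use assms(1) r r_half b in auto)
    have area: "annulus_boundary_area ?g r = n * \<omega> * \<sigma>"
    proof -
      have sph: "sphere_area ?g \<rho> = sqrt ((c powr (4 / (n - 2))) ^ (N - 1)) * (n * \<omega> * \<rho> ^ (N - 1))"
        if "\<rho> > 0" "\<And>x. norm x = \<rho> \<Longrightarrow> u x = c" for \<rho> c
        unfolding n(1) \<omega>(1) N_def using assms(1) that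
        by (intro sphere_area_conformally_flat) (auto simp: \<phi>_def flat_metric_def n(1) N_def)
      have "u x = 1" if "norm x = 1" for x
      proof -
        have "x \<noteq> 0" using that by auto
        then show ?thesis using that by (simp add: u_def green_factor_eq_norm)
      qed
      then have 1: "sphere_area ?g 1 = n * \<omega>" using sph[of 1 1] by simp
      have ur: "u x = 2 - b" if "norm x = r" for x
      proof -
        have x: "x \<noteq> 0" using that r by auto
        have "real (N - 2) = n - 2" using N by (simp add: n)
        then have "b = r powr (n - 2)" using powr_realpow[of r "N - 2"] r by (simp add: b_def)
        then have "b * r powr (2 - n) = 1" using r by (simp flip: powr_add)
        then show ?thesis using that by (simp add: u_def green_factor_eq_norm[OF x] flip: n_def)
      qed
      have "sqrt (((2 - b) powr (4 / (n - 2))) ^ (N - 1)) = (2 - b) powr (2 * (n - 1) / (n - 2))"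
        using sqrt_conformal_power[of "2 - b" "n - 2" "N - 1"] b N by (simp add: n of_nat_diff)
      then have "sphere_area ?g r = (2 - b) powr (2 * (n - 1) / (n - 2)) * (n * \<omega> * r ^ (N - 1))"
        using sph[of r "2 - b"] ur r by simp
      then show ?thesis unfolding annulus_boundary_area_def 1 \<sigma>_def by (simp add: algebra_simps)
    qed
    have \<sigma>1: "\<sigma> \<ge> 1" unfolding \<sigma>_def using r by simp
    \<comment> \<open>For $n \<ge> 3$ the exponent $2(n-1)/(n-2)$ is at most 4.\<close>
    have "(2 - b) powr (2 * (n - 1) / (n - 2)) \<le> 16"
    proof -
      have "(2 - b) powr (2 * (n - 1) / (n - 2)) \<le> (2 - b) powr 4"
        using b n by (intro powr_mono) (auto simp: field_simps)
      also have "\<dots> \<le> 2 powr 4" using b by (intro powr_mono2) auto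
      finally show ?thesis by simp
    qed
    then have "\<sigma> \<le> 1 + 16 * r ^ (N - 1)"
      unfolding \<sigma>_def using r by (intro add_left_mono mult_right_mono) auto
    then have "\<sigma> ^ N \<le> (1 + 16 * r ^ (N - 1)) ^ N" using \<sigma>1 by (intro power_mono) auto
    also have "\<dots> < v" unfolding v_def b_def using isoperimetric_comparison[OF N] r by simp
    finally have \<sigma>v: "\<sigma> ^ N < v" .
    \<comment> \<open>As $\<sigma> \<ge> 1$, it is enough to compare $v^{1/n}$ with $\<sigma>$ itself.\<close>
    have "\<sigma> powr (1 / (n - 1)) \<le> \<sigma> powr 1" using \<sigma>1 n by (intro powr_mono) auto
    also have "\<dots> = (\<sigma> ^ N) powr (1 / n)" using \<sigma>1 n by (simp add: powr_powr flip: powr_realpow)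
    also have "\<dots> < v powr (1 / n)" using \<sigma>v \<sigma>1 n by (intro powr_less_mono2) auto
    finally have key: "\<sigma> powr (1 / (n - 1)) < v powr (1 / n)" .
    have v: "v > 0" using \<sigma>v zero_le_power[of \<sigma> N] \<sigma>1 by linarith
    let ?q = "\<omega> powr (1 / n) / (n * \<omega>) powr (1 / (n - 1))"
    have "?q * 1 < ?q * (v powr (1 / n) / \<sigma> powr (1 / (n - 1)))"
      using key \<omega>(2) n(2) \<sigma>1 by (intro mult_strict_left_mono) auto
    also have "\<dots> = (\<omega> * v) powr (1 / n) / (n * \<omega> * \<sigma>) powr (1 / (n - 1))"
      using \<omega>(2) n(2) \<sigma>1 v by (simp add: powr_mult)
    also have "\<dots> \<le> metric_volume ?g (annulus r) powr (1 / n) / (n * \<omega> * \<sigma>) powr (1 / (n - 1))"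
      using vol \<omega> v n by (intro divide_right_mono powr_mono2) auto
    finally have ratio: "metric_volume ?g (annulus r) powr (1 / n) / annulus_boundary_area ?g r powr (1 / (n - 1))
           > \<omega> powr (1 / n) / sphere_area (flat_metric :: real^'n \<Rightarrow> real^'n^'n) 1 powr (1 / (n - 1))"
      unfolding area flat by simp
    show "\<exists>g :: real^'n \<Rightarrow> real^'n^'n.
         riemannian_metric_on (closure (annulus r)) g \<and>
         conformally_equivalent_on (closure (annulus r)) g flat_metric \<and>
         (\<forall>x\<in>annulus r. scalar_curvature g x = 0) \<and>
         metric_volume g (annulus r) powr (1 / n) / annulus_boundary_area g r powr (1 / (n - 1))
           > \<omega> powr (1 / n) / sphere_area (flat_metric :: real^'n \<Rightarrow> real^'n^'n) 1 powr (1 / (n - 1))"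
      using metric conf scal ratio by blast
  qed
qed

end
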